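(* Let $K$ be a field of characteristic zero and $n\ge 1$. Every weight left $\mathbb I_n$-module is a direct sum of simple weight $\mathbb I_n$-modules. In particular, the category of weight $\mathbb I_n$-modules is a semisimple category.
   Context: $P_n=K[x_1,\dots,x_n]$. The algebra $\mathbb I_n$ of polynomial integro-differential operators is the $K$-subalgebra of $\mathrm{End}_K(P_n)$ generated by the multiplications by $x_i$, the partial derivatives $\partial_i=\partial/\partial x_i$, and the integrations $\int_i$ (the $K$-linear maps $x^\alpha\mapsto x_ix^\alpha/(\alpha_i+1)$), $i=1,\dots,n$. Put $H_i=\partial_ix_i$; $D_n=K[H_1,\dots,H_n]\subset\mathbb I_n$ is a polynomial algebra. For $\lambda\in K^n$ and an $\mathbb I_n$-module $M$ put $M_\lambda=\{v\in M: H_iv=\lambda_iv,\ i=1,\dots,n\}$. $M$ is a weight module if $M=\bigoplus_{\lambda\in K^n}M_\lambda$. A category of modules (a full subcategory of the category of all left $\mathbb I_n$-modules) is semisimple if every module in it is a direct sum of simple modules belonging to it. *)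

theory Defs
  imports
    "HOL-Library.Poly_Mapping"
    "HOL-Algebra.Module"
    "HOL-Algebra.Generated_Rings"
    "HOL-Algebra.Product_Groups"
begin

section \<open>Polynomial integro-differential operators\<close>

text \<open>Polynomials over \<open>'k\<close> in variables indexed by the finite type \<open>'n\<close>, so that the number of
  variables is \<open>CARD('n)\<close>; monomials are identified with their exponent vectors
  \<open>'n \<Rightarrow>\<^sub>0 nat\<close>.\<close>

type_synonym ('n, 'k) mpoly = "('n \<Rightarrow>\<^sub>0 nat) \<Rightarrow>\<^sub>0 'k"
type_synonym ('n, 'k) mpoly_op = "('n, 'k) mpoly \<Rightarrow> ('n, 'k) mpoly"

definition scalar_op :: "'k \<Rightarrow> ('n::finite, 'k::field_char_0) mpoly_op" where
  "scalar_op c p = Poly_Mapping.map ((*) c) p"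

definition mult_op :: "'n \<Rightarrow> ('n::finite, 'k::field_char_0) mpoly_op" where
  "mult_op i p = Poly_Mapping.single (Poly_Mapping.single i 1) 1 * p"

text \<open>If \<open>i\<close> does not occur in \<open>\<alpha>\<close>, the exponent \<open>\<alpha> - single i 1\<close> below is truncated,
  but then the coefficient is zero.\<close>

definition deriv_op :: "'n \<Rightarrow> ('n::finite, 'k::field_char_0) mpoly_op" where
  "deriv_op i p = (\<Sum>\<alpha>\<in>Poly_Mapping.keys p. Poly_Mapping.single (\<alpha> - Poly_Mapping.single i 1)
      (of_nat (Poly_Mapping.lookup \<alpha> i) * Poly_Mapping.lookup p \<alpha>))"

definition integ_op :: "'n \<Rightarrow> ('n::finite, 'k::field_char_0) mpoly_op" where
  "integ_op i p = (\<Sum>\<alpha>\<in>Poly_Mapping.keys p. Poly_Mapping.single (\<alpha> + Poly_Mapping.single i 1)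
      (Poly_Mapping.lookup p \<alpha> / of_nat (Poly_Mapping.lookup \<alpha> i + 1)))"

definition End_ring :: "('n::finite, 'k::field_char_0) mpoly_op ring" where
  "End_ring = \<lparr>carrier = {f. Vector_Spaces.linear scalar_op scalar_op f},
     monoid.mult = (\<circ>), one = id, zero = (\<lambda>_. 0), add = (\<lambda>f g p. f p + g p)\<rparr>"

text \<open>The \<open>K\<close>-subalgebra generated by a set is the subring generated by that set together with
  the scalar operators.\<close>

definition IDO :: "('n::finite, 'k::field_char_0) mpoly_op ring" where
  "IDO = End_ring\<lparr>carrier := generate_ring End_ring
     (range scalar_op \<union> range mult_op \<union> range deriv_op \<union> range integ_op)\<rparr>"

definition H_op :: "'n \<Rightarrow> ('n::finite, 'k::field_char_0) mpoly_op" where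
  "H_op i = deriv_op i \<circ> mult_op i"


section \<open>Left modules, simple modules, direct sums\<close>

text \<open>The library's locale \<open>module\<close> requires a commutative ring; the axioms are the same.\<close>

locale left_module = R?: ring R + M?: abelian_group M
  for R :: "('a, 'c) ring_scheme" (structure) and M :: "('a, 'm, 'd) module_scheme" (structure) +
  assumes smult_closed [simp, intro]:
      "\<lbrakk>a \<in> carrier R; x \<in> carrier M\<rbrakk> \<Longrightarrow> a \<odot>\<^bsub>M\<^esub> x \<in> carrier M"
    and smult_l_distr:
      "\<lbrakk>a \<in> carrier R; b \<in> carrier R; x \<in> carrier M\<rbrakk> \<Longrightarrow>
        (a \<oplus>\<^bsub>R\<^esub> b) \<odot>\<^bsub>M\<^esub> x = a \<odot>\<^bsub>M\<^esub> x \<oplus>\<^bsub>M\<^esub> b \<odot>\<^bsub>M\<^esub> x"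
    and smult_r_distr:
      "\<lbrakk>a \<in> carrier R; x \<in> carrier M; y \<in> carrier M\<rbrakk> \<Longrightarrow>
        a \<odot>\<^bsub>M\<^esub> (x \<oplus>\<^bsub>M\<^esub> y) = a \<odot>\<^bsub>M\<^esub> x \<oplus>\<^bsub>M\<^esub> a \<odot>\<^bsub>M\<^esub> y"
    and smult_assoc:
      "\<lbrakk>a \<in> carrier R; b \<in> carrier R; x \<in> carrier M\<rbrakk> \<Longrightarrow>
        (a \<otimes>\<^bsub>R\<^esub> b) \<odot>\<^bsub>M\<^esub> x = a \<odot>\<^bsub>M\<^esub> (b \<odot>\<^bsub>M\<^esub> x)"
    and smult_one [simp]: "x \<in> carrier M \<Longrightarrow> \<one>\<^bsub>R\<^esub> \<odot>\<^bsub>M\<^esub> x = x"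

definition simple_module :: "('a, 'c) ring_scheme \<Rightarrow> ('a, 'm) module \<Rightarrow> bool" where
  "simple_module R M \<longleftrightarrow> left_module R M \<and> carrier M \<noteq> {\<zero>\<^bsub>M\<^esub>} \<and>
     (\<forall>N. submodule N R M \<longrightarrow> N = {\<zero>\<^bsub>M\<^esub>} \<or> N = carrier M)"

text \<open>\<open>M\<close> is the internal direct sum of the additive subgroups \<open>N i\<close>, \<open>i \<in> I\<close>: the summation map
  from the external direct sum (finitely supported families) to \<open>M\<close> is an isomorphism. If the
  \<open>N i\<close> are submodules (or \<open>K\<close>-subspaces), this map is automatically linear.\<close>

definition internal_direct_sum :: "('a, 'm) module \<Rightarrow> 'i set \<Rightarrow> ('i \<Rightarrow> 'm set) \<Rightarrow> bool" where
  "internal_direct_sum M I N \<longleftrightarrow>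
     (\<forall>i\<in>I. subgroup (N i) (add_monoid M)) \<and>
     (\<lambda>v. \<Oplus>\<^bsub>M\<^esub>i\<in>{i\<in>I. v i \<noteq> \<zero>\<^bsub>M\<^esub>}. v i)
       \<in> iso (sum_group I (\<lambda>i. (add_monoid M)\<lparr>carrier := N i\<rparr>)) (add_monoid M)"

text \<open>\<open>M\<close> is a direct sum of simple modules belonging to the class \<open>C\<close>. Since simple modules are
  nonzero, the summands of an internal direct sum are pairwise distinct, so the family of
  summands may be given as a set of submodules.\<close>

definition direct_sum_of_simples ::
    "('a, 'c) ring_scheme \<Rightarrow> (('a, 'm) module \<Rightarrow> bool) \<Rightarrow> ('a, 'm) module \<Rightarrow> bool" where
  "direct_sum_of_simples R C M \<longleftrightarrow>
     (\<exists>\<S>. (\<forall>N\<in>\<S>. submodule N R M \<and> simple_module R (M\<lparr>carrier := N\<rparr>) \<and> C (M\<lparr>carrier := N\<rparr>)) \<and>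
          internal_direct_sum M \<S> (\<lambda>N. N))"

text \<open>A full subcategory of the category of left \<open>R\<close>-modules is given by its class \<open>C\<close> of objects.\<close>

definition semisimple_category ::
    "('a, 'c) ring_scheme \<Rightarrow> (('a, 'm) module \<Rightarrow> bool) \<Rightarrow> bool" where
  "semisimple_category R C \<longleftrightarrow>
     (\<forall>M. C M \<longrightarrow> left_module R M \<and> direct_sum_of_simples R C M)"


section \<open>Weight modules\<close>

text \<open>An \<open>IDO\<close>-module is a \<open>K\<close>-vector space via the scalar operators.\<close>

definition weight_space ::
    "(('n::finite, 'k::field_char_0) mpoly_op, 'm) module \<Rightarrow> ('n \<Rightarrow> 'k) \<Rightarrow> 'm set" where
  "weight_space M \<mu> = {v \<in> carrier M. \<forall>i. H_op i \<odot>\<^bsub>M\<^esub> v = scalar_op (\<mu> i) \<odot>\<^bsub>M\<^esub> v}"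

definition weight_module :: "(('n::finite, 'k::field_char_0) mpoly_op, 'm) module \<Rightarrow> bool" where
  "weight_module M \<longleftrightarrow> left_module IDO M \<and> internal_direct_sum M UNIV (weight_space M)"


section \<open>Well-formedness\<close>

lemma scalar_op_lookup: "Poly_Mapping.lookup (scalar_op c p) \<alpha> = c * Poly_Mapping.lookup p \<alpha>"
  by (simp add: scalar_op_def Poly_Mapping.map.rep_eq when_def)

lemma mult_op_single:
  "mult_op i (Poly_Mapping.single \<alpha> c) = Poly_Mapping.single (\<alpha> + Poly_Mapping.single i 1) c"
  by (simp add: mult_op_def mult_single add.commute)

lemma deriv_op_single:
  "deriv_op i (Poly_Mapping.single \<alpha> c) =
     Poly_Mapping.single (\<alpha> - Poly_Mapping.single i 1) (of_nat (Poly_Mapping.lookup \<alpha> i) * c)"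
  by (cases "c = 0") (simp_all add: deriv_op_def)

lemma integ_op_single:
  "integ_op i (Poly_Mapping.single \<alpha> c) =
     Poly_Mapping.single (\<alpha> + Poly_Mapping.single i 1) (c / of_nat (Poly_Mapping.lookup \<alpha> i + 1))"
  by (cases "c = 0") (simp_all add: integ_op_def)

interpretation scalar: vector_space scalar_op
  by unfold_locales
    (auto intro!: poly_mapping_eqI simp: scalar_op_lookup lookup_add algebra_simps)

lemma linear_scalar_iff:
  fixes f :: "('n::finite, 'k::field_char_0) mpoly_op"
  shows "Vector_Spaces.linear scalar_op scalar_op f \<longleftrightarrow>
     (\<forall>p q. f (p + q) = f p + f q) \<and> (\<forall>c p. f (scalar_op c p) = scalar_op c (f p))"
  unfolding Vector_Spaces.linear_def module_hom_def module_hom_axioms_def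
  using scalar.vector_space_axioms scalar.module_axioms by auto

lemma ring_End_ring: "ring (End_ring :: ('n::finite, 'k::field_char_0) mpoly_op ring)"
proof (rule ringI)
  show "abelian_group (End_ring :: ('n, 'k) mpoly_op ring)"
  proof (rule abelian_groupI)
    fix f :: "('n, 'k) mpoly_op" assume f: "f \<in> carrier End_ring"
    then have "(\<lambda>p. - f p) \<in> carrier End_ring"
      by (auto simp: End_ring_def linear_scalar_iff)
    then show "\<exists>g\<in>carrier End_ring. g \<oplus>\<^bsub>End_ring\<^esub> f = \<zero>\<^bsub>End_ring\<^esub>"
      by (rule bexI[rotated]) (simp add: End_ring_def)
  qed (auto simp: End_ring_def linear_scalar_iff add_ac scalar.scale_right_distrib)
  show "monoid (End_ring :: ('n, 'k) mpoly_op ring)"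
    by (rule monoidI) (auto simp: End_ring_def linear_scalar_iff comp_def)
qed (auto simp: End_ring_def linear_scalar_iff)

lemma linear_mult_op: "mult_op i \<in> carrier End_ring"
  by (auto simp: End_ring_def linear_scalar_iff mult_op_def scalar_op_def algebra_simps
      mult_map_scale_conv_mult)

lemma linear_scalar_op: "scalar_op c \<in> carrier End_ring"
  by (auto simp: End_ring_def linear_scalar_iff scalar.scale_right_distrib scalar.scale_left_commute)

lemma sum_keys_linear:
  fixes p q :: "('n::finite, 'k::field_char_0) mpoly"
  assumes F: "\<And>p. F p = (\<Sum>\<alpha>\<in>Poly_Mapping.keys p.
      Poly_Mapping.single (g \<alpha>) (h \<alpha> * Poly_Mapping.lookup p \<alpha>))"
  shows "F \<in> carrier End_ring"
proof -
  have F': "F p = (\<Sum>\<alpha>\<in>A. Poly_Mapping.single (g \<alpha>) (h \<alpha> * Poly_Mapping.lookup p \<alpha>))"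
    if "finite A" "Poly_Mapping.keys p \<subseteq> A" for p A
    unfolding F by (rule sum.mono_neutral_left) (use that in \<open>auto simp: in_keys_iff\<close>)
  have "F (p + q) = F p + F q" for p q
  proof -
    let ?A = "Poly_Mapping.keys p \<union> Poly_Mapping.keys q"
    have "Poly_Mapping.keys (p + q) \<subseteq> ?A" by (rule Poly_Mapping.keys_add)
    then show ?thesis
      by (subst (1 2 3) F'[where A = ?A])
        (auto simp: lookup_add distrib_left single_add sum.distrib)
  qed
  moreover have "F (scalar_op c p) = scalar_op c (F p)" for c p
  proof -
    have *: "scalar_op c (Poly_Mapping.single \<alpha> x) = Poly_Mapping.single \<alpha> (c * x)" for \<alpha> x
      by (rule poly_mapping_eqI) (simp add: scalar_op_lookup lookup_single when_def)
    have "Poly_Mapping.keys (scalar_op c p) \<subseteq> Poly_Mapping.keys p"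
      by (auto simp: in_keys_iff scalar_op_lookup)
    then show ?thesis
      by (subst (1 2) F'[where A = "Poly_Mapping.keys p"])
        (auto simp: scalar_op_lookup scalar.scale_sum_right * mult_ac)
  qed
  ultimately show ?thesis by (simp add: End_ring_def linear_scalar_iff)
qed

lemma linear_deriv_op: "deriv_op i \<in> carrier End_ring"
  by (rule sum_keys_linear) (simp add: deriv_op_def)

lemma linear_integ_op: "integ_op i \<in> carrier End_ring"
  by (rule sum_keys_linear[where h = "\<lambda>\<alpha>. inverse (of_nat (Poly_Mapping.lookup \<alpha> i + 1))"])
    (simp add: integ_op_def divide_inverse mult.commute)

lemma ring_IDO: "ring IDO"
  unfolding IDO_def
  by (rule ring.generate_ring_is_ring[OF ring_End_ring])
    (auto simp: linear_scalar_op linear_mult_op linear_deriv_op linear_integ_op)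

end

theory Submission
  imports Defs
begin

text \<open>Since \<open>\<partial>\<^sub>i \<integral>\<^sub>i = 1\<close>, the operator \<open>e\<^sub>i = 1 - \<integral>\<^sub>i \<partial>\<^sub>i\<close> projects onto the kernel of \<open>\<partial>\<^sub>i\<close>, and \<open>H\<^sub>i e\<^sub>i = e\<^sub>i\<close>
  shows that it kills every weight space with \<open>\<lambda>\<^sub>i \<noteq> 1\<close>. Repeatedly splitting \<open>v = e\<^sub>i v + \<integral>\<^sub>i \<partial>\<^sub>i v\<close> therefore
  writes each weight vector as a sum of vectors obtained by integrations from weight vectors \<open>v\<close> that are
  pure in every direction \<open>i\<close>: either \<open>\<partial>\<^sub>i v = 0\<close>, or \<open>\<integral>\<^sub>i\<close> and \<open>\<partial>\<^sub>i\<close> are mutually inverse on the vectors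
  obtained from \<open>v\<close>. For such \<open>v\<close> and \<open>z \<in> \<int>\<^sup>n\<close> the vectors \<open>\<Prod>\<^sub>i \<integral>\<^sub>i\<^bsup>z\<^sub>i\<^esup> v\<close>, with negative powers of \<open>\<integral>\<^sub>i\<close> read as
  powers of \<open>\<partial>\<^sub>i\<close>, span a submodule with one-dimensional weight spaces, and each nonzero one of them leads
  back to \<open>v\<close>. As submodules of weight modules contain the weight components of their elements, this
  submodule is simple. So a weight module is a sum of simple submodules, hence, by Zorn's lemma, a direct sum
  of some of them.\<close>

section \<open>Internal direct sums\<close>

text \<open>For subgroups \<open>N i\<close> this is their sum: terms from the same
  \<open>N i\<close> can be merged, so one term per index suffices.\<close>

definition finite_sums :: "('a, 'm) ring_scheme \<Rightarrow> 'i set \<Rightarrow> ('i \<Rightarrow> 'a set) \<Rightarrow> 'a set" where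
  "finite_sums G I N = {finsum G v F | v F. finite F \<and> F \<subseteq> I \<and> v \<in> Pi F N}"

text \<open>Uniqueness of decompositions in finitary form: each test involves only a finite
  \<open>F\<close>, which lets the property pass to unions of chains.\<close>

definition independent_family :: "('a, 'm) ring_scheme \<Rightarrow> 'i set \<Rightarrow> ('i \<Rightarrow> 'a set) \<Rightarrow> bool" where
  "independent_family G I N \<longleftrightarrow>
     (\<forall>F v. finite F \<and> F \<subseteq> I \<and> v \<in> Pi F N \<and> finsum G v F = \<zero>\<^bsub>G\<^esub> \<longrightarrow> (\<forall>i\<in>F. v i = \<zero>\<^bsub>G\<^esub>))"

lemma (in abelian_group) subgroup_add_facts:
  assumes "subgroup H (add_monoid G)"
  shows "\<zero> \<in> H" "H \<subseteq> carrier G" "\<And>x. x \<in> H \<Longrightarrow> \<ominus> x \<in> H" "\<And>x y. x \<in> H \<Longrightarrow> y \<in> H \<Longrightarrow> x \<oplus> y \<in> H"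
  using subgroup.one_closed[OF assms] subgroup.subset[OF assms] subgroup.m_inv_closed[OF assms]
    subgroup.m_closed[OF assms]
  by (simp_all add: a_inv_def)

lemma (in abelian_group) finsum_in_subgroup:
  assumes "subgroup H (add_monoid G)" "v \<in> F \<rightarrow> H"
  shows "finsum G v F \<in> H"
  using assms(2)
proof (induction F rule: infinite_finite_induct)
  case (insert i F)
  then have "v \<in> F \<rightarrow> carrier G" "v i \<in> carrier G"
    using subgroup_add_facts(2)[OF assms(1)] by auto
  with insert show ?case
    using subgroup_add_facts(4)[OF assms(1)] by auto
qed (use subgroup_add_facts(1)[OF assms(1)] in \<open>auto simp: finsum_infinite\<close>)

text \<open>Brings two finite sums over different index sets to a common one, so that they can be
  added termwise.\<close>

lemma (in abelian_group) finsum_extend_zero: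
  assumes "finite F" "E \<subseteq> F" "v \<in> E \<rightarrow> carrier G"
  shows "finsum G v E = finsum G (\<lambda>i. if i \<in> E then v i else \<zero>) F"
  by (rule add.finprod_mono_neutral_cong_left) (use assms in auto)

lemma (in abelian_group) finite_sums_add:
  assumes N: "\<And>i. i \<in> I \<Longrightarrow> subgroup (N i) (add_monoid G)"
    and x: "x \<in> finite_sums G I N" and y: "y \<in> finite_sums G I N"
  shows "x \<oplus> y \<in> finite_sums G I N"
proof -
  obtain v E where v: "finite E" "E \<subseteq> I" "v \<in> Pi E N" "x = finsum G v E"
    using x by (auto simp: finite_sums_def)
  obtain w F where w: "finite F" "F \<subseteq> I" "w \<in> Pi F N" "y = finsum G w F"
    using y by (auto simp: finite_sums_def)
  let ?v = "\<lambda>i. if i \<in> E then v i else \<zero>" and ?w = "\<lambda>i. if i \<in> F then w i else \<zero>"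
  have mem: "?v i \<in> N i" "?w i \<in> N i" "N i \<subseteq> carrier G" if "i \<in> E \<union> F" for i
    using that v w subgroup_add_facts(1)[OF N] subgroup_add_facts(2)[OF N, of i] by (auto split: if_splits)
  have "v \<in> E \<rightarrow> carrier G" "w \<in> F \<rightarrow> carrier G"
    using v(3) w(3) by (auto simp: Pi_iff intro: subsetD[OF mem(3)])
  then have xy: "x = finsum G ?v (E \<union> F)" "y = finsum G ?w (E \<union> F)"
    unfolding v(4) w(4) using v(1) w(1)
    by - (rule finsum_extend_zero, simp, simp, assumption)+
  have "?v \<in> E \<union> F \<rightarrow> carrier G" "?w \<in> E \<union> F \<rightarrow> carrier G"
    by (rule Pi_I, rule subsetD[OF mem(3)], assumption, erule mem(1,2))+
  then have "x \<oplus> y = finsum G (\<lambda>i. ?v i \<oplus> ?w i) (E \<union> F)"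
    unfolding xy by (rule finsum_addf[symmetric])
  moreover have "(\<lambda>i. ?v i \<oplus> ?w i) \<in> Pi (E \<union> F) N"
    using v(2) w(2) by (intro Pi_I subgroup_add_facts(4)[OF N] mem(1,2)) auto
  ultimately show ?thesis
    using v w unfolding finite_sums_def by blast
qed

lemma (in abelian_group) finite_sums_incl:
  assumes "i \<in> I" "x \<in> N i" "N i \<subseteq> carrier G"
  shows "x \<in> finite_sums G I N"
  unfolding finite_sums_def using assms
  by (intro CollectI exI[of _ "\<lambda>_. x"] exI[of _ "{i}"]) auto

text \<open>Additivity propagates membership in \<open>L\<close> from the summands to the sum.
  Closure of a sum of subgroups under a ring element is thereby checked on each \<open>N i\<close>
  separately.\<close>

lemma (in abelian_group) finite_sums_map:
  assumes N: "\<And>i. i \<in> I \<Longrightarrow> N i \<subseteq> carrier G"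
    and h: "\<And>i x. i \<in> I \<Longrightarrow> x \<in> N i \<Longrightarrow> h x \<in> L"
    and h_zero: "h \<zero> = \<zero>"
    and h_add: "\<And>x y. x \<in> carrier G \<Longrightarrow> y \<in> carrier G \<Longrightarrow> h (x \<oplus> y) = h x \<oplus> h y"
    and L: "\<zero> \<in> L" "\<And>x y. x \<in> L \<Longrightarrow> y \<in> L \<Longrightarrow> x \<oplus> y \<in> L"
    and x: "x \<in> finite_sums G I N"
  shows "h x \<in> L"
proof -
  obtain v F where v: "finite F" "F \<subseteq> I" "v \<in> Pi F N" "x = finsum G v F"
    using x by (auto simp: finite_sums_def)
  have "h (finsum G v F) \<in> L"
    using v(1-3)
  proof (induction F)
    case (insert i F)
    then have "v \<in> F \<rightarrow> carrier G" "v i \<in> carrier G"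
      using N by (fastforce simp: Pi_iff)+
    with insert show ?case by (auto simp: h_add intro: L h)
  qed (simp add: h_zero L)
  then show ?thesis by (simp add: v)
qed

lemma group_add_monoid_subgroup:
  assumes "abelian_group M" "subgroup H (add_monoid M)"
  shows "group ((add_monoid M)\<lparr>carrier := H\<rparr>)"
  using subgroup.subgroup_is_group[OF assms(2) abelian_group.a_group[OF assms(1)]] .

text \<open>Spanning makes the summation map surjective, and independence makes its kernel
  trivial.\<close>

lemma internal_direct_sumI:
  fixes M :: "('a, 'm) module"
  assumes M: "abelian_group M"
    and N: "\<And>i. i \<in> I \<Longrightarrow> subgroup (N i) (add_monoid M)"
    and span: "carrier M \<subseteq> finite_sums M I N"
    and indep: "independent_family M I N"
  shows "internal_direct_sum M I N"
proof -
  interpret abelian_group M by fact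
  define S where "S = sum_group I (\<lambda>i. (add_monoid M)\<lparr>carrier := N i\<rparr>)"
  let ?h = "\<lambda>v. \<Oplus>\<^bsub>M\<^esub>i\<in>{i\<in>I. v i \<noteq> \<zero>\<^bsub>M\<^esub>}. v i"
  note gr = group_add_monoid_subgroup[OF M N]
  have carr: "carrier S = {x \<in> PiE I N. finite {i\<in>I. x i \<noteq> \<zero>\<^bsub>M\<^esub>}}"
    unfolding S_def using gr by (subst carrier_sum_group) auto
  have mult: "x \<otimes>\<^bsub>S\<^esub> y = (\<lambda>i\<in>I. x i \<oplus>\<^bsub>M\<^esub> y i)" and one: "\<one>\<^bsub>S\<^esub> = (\<lambda>i\<in>I. \<zero>\<^bsub>M\<^esub>)" for x y
    by (simp_all add: S_def)
  have group_S: "group S"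
    unfolding S_def using gr by (rule sum_group)
  have Nc: "N i \<subseteq> carrier M" if "i \<in> I" for i
    using subgroup_add_facts(2)[OF N[OF that]] .
  \<comment> \<open>The summation map uses the support of \<open>v\<close>, which varies with
    \<open>v\<close>; any finite set containing the support gives the same value, so two families
    can share one index set.\<close>
  have h_eq: "?h v = finsum M v F"
    if "finite F" "F \<subseteq> I" "v \<in> Pi F N" "\<And>i. i \<in> I - F \<Longrightarrow> v i = \<zero>\<^bsub>M\<^esub>" for v F
    by (rule add.finprod_mono_neutral_cong_left) (use that Nc in \<open>fastforce simp: Pi_iff\<close>)+
  have hom: "?h \<in> hom S (add_monoid M)"
  proof (rule homI)
    fix x assume "x \<in> carrier S"
    then show "?h x \<in> carrier (add_monoid M)"
      using Nc by (auto simp: carr PiE_iff Pi_iff intro!: finsum_closed)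
  next
    fix x y assume x: "x \<in> carrier S" and y: "y \<in> carrier S"
    let ?F = "{i\<in>I. x i \<noteq> \<zero>\<^bsub>M\<^esub>} \<union> {i\<in>I. y i \<noteq> \<zero>\<^bsub>M\<^esub>}"
    have F: "finite ?F" "?F \<subseteq> I" and xy: "x \<in> Pi ?F N" "y \<in> Pi ?F N"
      using x y by (auto simp: carr PiE_iff)
    have xc: "x \<in> ?F \<rightarrow> carrier M" "y \<in> ?F \<rightarrow> carrier M"
      using xy Nc by (fastforce simp: Pi_iff)+
    have "?h (x \<otimes>\<^bsub>S\<^esub> y) = finsum M (x \<otimes>\<^bsub>S\<^esub> y) ?F"
      using F xy subgroup_add_facts(4)[OF N] by (intro h_eq) (auto simp: Pi_iff mult)
    also have "\<dots> = finsum M (\<lambda>i. x i \<oplus>\<^bsub>M\<^esub> y i) ?F"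
      using xc by (intro add.finprod_cong') (auto simp: mult)
    also have "\<dots> = finsum M x ?F \<oplus>\<^bsub>M\<^esub> finsum M y ?F"
      using xc by (rule finsum_addf)
    also have "\<dots> = ?h x \<oplus>\<^bsub>M\<^esub> ?h y"
      using F xy by (subst (1 2) h_eq[of ?F]) auto
    finally show "?h (x \<otimes>\<^bsub>S\<^esub> y) = ?h x \<otimes>\<^bsub>add_monoid M\<^esub> ?h y" by simp
  qed
  have "inj_on ?h (carrier S)"
  proof (rule inj_on_one_iff'[OF hom group_S a_group, THEN iffD2])
    show "\<forall>x. x \<in> carrier S \<longrightarrow> ?h x = \<one>\<^bsub>add_monoid M\<^esub> \<longrightarrow> x = \<one>\<^bsub>S\<^esub>"
    proof (intro allI impI)
      fix x assume x: "x \<in> carrier S" and "?h x = \<one>\<^bsub>add_monoid M\<^esub>"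
      then have h0: "finsum M x {i\<in>I. x i \<noteq> \<zero>\<^bsub>M\<^esub>} = \<zero>\<^bsub>M\<^esub>" by simp
      have fin: "finite {i\<in>I. x i \<noteq> \<zero>\<^bsub>M\<^esub>}" "x \<in> Pi {i\<in>I. x i \<noteq> \<zero>\<^bsub>M\<^esub>} N"
        using x by (auto simp: carr PiE_iff)
      have "{i\<in>I. x i \<noteq> \<zero>\<^bsub>M\<^esub>} \<subseteq> I" by auto
      then have z: "\<forall>i\<in>{i\<in>I. x i \<noteq> \<zero>\<^bsub>M\<^esub>}. x i = \<zero>\<^bsub>M\<^esub>"
        using fin h0
        by (intro indep[unfolded independent_family_def, THEN spec, THEN spec, THEN mp] conjI)
      show "x = \<one>\<^bsub>S\<^esub>"
      proof
        fix i show "x i = \<one>\<^bsub>S\<^esub> i"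
        proof (cases "i \<in> I")
          case True
          then show ?thesis using z by (cases "x i = \<zero>\<^bsub>M\<^esub>") (auto simp: one)
        next
          case False
          have "x \<in> PiE I N" using x unfolding carr by blast
          from PiE_arb[OF this False] show ?thesis using False by (simp add: one)
        qed
      qed
    qed
  qed
  moreover have "?h ` carrier S = carrier M"
  proof
    show "?h ` carrier S \<subseteq> carrier M"
      using hom_carrier[OF hom] by simp
    show "carrier M \<subseteq> ?h ` carrier S"
    proof
      fix x assume "x \<in> carrier M"
      then obtain v F where v: "finite F" "F \<subseteq> I" "v \<in> Pi F N" "x = finsum M v F"
        using span by (auto simp: finite_sums_def)
      \<comment> \<open>Elements of \<open>S\<close> are extensional on \<open>I\<close>, so the
        finite family is filled up with zeros inside \<open>I\<close> and restricted to it.\<close>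
      define w where "w = (\<lambda>i\<in>I. if i \<in> F then v i else \<zero>\<^bsub>M\<^esub>)"
      have "{i \<in> I. w i \<noteq> \<zero>\<^bsub>M\<^esub>} \<subseteq> F" by (auto simp: w_def split: if_splits)
      then have "w \<in> carrier S"
        using v subgroup_add_facts(1)[OF N] by (auto simp: carr w_def Pi_iff intro: finite_subset)
      moreover have "?h w = finsum M w F"
        using v by (intro h_eq) (auto simp: w_def Pi_iff)
      moreover have "\<dots> = x"
        unfolding v(4) using v Nc by (intro add.finprod_cong') (fastforce simp: w_def Pi_iff)+
      ultimately show "x \<in> ?h ` carrier S" by force
    qed
  qed
  ultimately show ?thesis
    using hom N unfolding internal_direct_sum_def iso_def bij_betw_def S_def by simp
qed

text \<open>Read off from surjectivity of the summation map: a preimage is a finitely supported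
  family, and its support is the index set sought.\<close>

lemma internal_direct_sum_span:
  fixes M :: "('a, 'm) module"
  assumes M: "abelian_group M" and sum: "internal_direct_sum M I N"
  shows "carrier M \<subseteq> finite_sums M I N"
proof
  interpret abelian_group M by fact
  fix x assume x: "x \<in> carrier M"
  define S where "S = sum_group I (\<lambda>i. (add_monoid M)\<lparr>carrier := N i\<rparr>)"
  let ?h = "\<lambda>v. \<Oplus>\<^bsub>M\<^esub>i\<in>{i\<in>I. v i \<noteq> \<zero>\<^bsub>M\<^esub>}. v i"
  have N: "subgroup (N i) (add_monoid M)" if "i \<in> I" for i
    using sum that by (simp add: internal_direct_sum_def)
  have carr: "carrier S = {x \<in> PiE I N. finite {i\<in>I. x i \<noteq> \<zero>\<^bsub>M\<^esub>}}"
    using group_add_monoid_subgroup[OF M N] unfolding S_def by (subst carrier_sum_group) auto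
  have "x \<in> ?h ` carrier S"
    using sum x by (simp add: internal_direct_sum_def iso_def bij_betw_def S_def)
  then obtain v where v: "v \<in> carrier S" "x = ?h v" by blast
  then show "x \<in> finite_sums M I N"
    unfolding finite_sums_def
    by (intro CollectI exI[of _ v] exI[of _ "{i\<in>I. v i \<noteq> \<zero>\<^bsub>M\<^esub>}"]) (auto simp: carr PiE_iff)
qed

section \<open>Sums of simple submodules\<close>

context left_module
begin

lemma smult_r_null [simp]: "a \<in> carrier R \<Longrightarrow> a \<odot>\<^bsub>M\<^esub> \<zero>\<^bsub>M\<^esub> = \<zero>\<^bsub>M\<^esub>"
  by (metis M.add.r_cancel_one' M.zero_closed M.l_zero smult_closed smult_r_distr)

lemma smult_l_null [simp]: "x \<in> carrier M \<Longrightarrow> \<zero> \<odot>\<^bsub>M\<^esub> x = \<zero>\<^bsub>M\<^esub>"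
  by (metis M.add.r_cancel_one' R.zero_closed R.l_zero smult_closed smult_l_distr)

lemma smult_l_minus: "\<lbrakk>a \<in> carrier R; x \<in> carrier M\<rbrakk> \<Longrightarrow> (\<ominus> a) \<odot>\<^bsub>M\<^esub> x = \<ominus>\<^bsub>M\<^esub> (a \<odot>\<^bsub>M\<^esub> x)"
  by (metis M.minus_equality R.a_inv_closed R.l_neg smult_closed smult_l_distr smult_l_null)

lemma minus_eq_smult: "x \<in> carrier M \<Longrightarrow> \<ominus>\<^bsub>M\<^esub> x = (\<ominus> \<one>) \<odot>\<^bsub>M\<^esub> x"
  by (simp add: smult_l_minus)

lemma finsum_smult:
  assumes "a \<in> carrier R" "f \<in> A \<rightarrow> carrier M"
  shows "a \<odot>\<^bsub>M\<^esub> (\<Oplus>\<^bsub>M\<^esub>i\<in>A. f i) = (\<Oplus>\<^bsub>M\<^esub>i\<in>A. a \<odot>\<^bsub>M\<^esub> f i)"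
  using assms(2)
proof (induction A rule: infinite_finite_induct)
  case (insert i F)
  then have "f \<in> F \<rightarrow> carrier M" "f i \<in> carrier M" "(\<lambda>i. a \<odot>\<^bsub>M\<^esub> f i) \<in> F \<rightarrow> carrier M"
    using assms(1) by auto
  with insert assms(1) show ?case
    by (simp add: smult_r_distr)
qed (use assms(1) in \<open>auto simp: M.finsum_infinite\<close>)

lemma submoduleI:
  assumes "H \<subseteq> carrier M" "\<zero>\<^bsub>M\<^esub> \<in> H"
    and "\<And>x y. \<lbrakk>x \<in> H; y \<in> H\<rbrakk> \<Longrightarrow> x \<oplus>\<^bsub>M\<^esub> y \<in> H"
    and smult: "\<And>a x. \<lbrakk>a \<in> carrier R; x \<in> H\<rbrakk> \<Longrightarrow> a \<odot>\<^bsub>M\<^esub> x \<in> H"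
  shows "submodule H R M"
proof -
  have "\<ominus>\<^bsub>M\<^esub> x \<in> H" if "x \<in> H" for x
    using that assms(1) smult[of "\<ominus> \<one>" x] by (simp add: minus_eq_smult subsetD)
  then show ?thesis
    using assms by (intro submodule.intro subgroup.intro submodule_axioms.intro) (auto simp: a_inv_def)
qed

lemma submoduleD:
  assumes "submodule H R M"
  shows "H \<subseteq> carrier M" "\<zero>\<^bsub>M\<^esub> \<in> H"
    "\<And>x. x \<in> H \<Longrightarrow> \<ominus>\<^bsub>M\<^esub> x \<in> H" "\<And>x y. x \<in> H \<Longrightarrow> y \<in> H \<Longrightarrow> x \<oplus>\<^bsub>M\<^esub> y \<in> H"
    "\<And>a x. a \<in> carrier R \<Longrightarrow> x \<in> H \<Longrightarrow> a \<odot>\<^bsub>M\<^esub> x \<in> H"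
    "subgroup H (add_monoid M)"
  using M.subgroup_add_facts[OF submodule.axioms(1)[OF assms]] submodule.smult_closed[OF assms]
    submodule.axioms(1)[OF assms] by auto

lemma submodule_Int:
  assumes "submodule H R M" "submodule K R M"
  shows "submodule (H \<inter> K) R M"
  using submoduleD[OF assms(1)] submoduleD[OF assms(2)] by (intro submoduleI) auto

lemma submodule_left_module:
  assumes "submodule H R M"
  shows "left_module R (M\<lparr>carrier := H\<rparr>)"
proof -
  note H = submoduleD[OF assms]
  have "abelian_group (M\<lparr>carrier := H\<rparr>)"
    using H by (intro abelian_groupI) (auto simp: M.a_assoc subset_iff intro: M.a_comm M.l_neg)
  then show ?thesis
    using H by (intro left_module.intro left_module_axioms.intro)
      (auto simp: R.ring_axioms smult_l_distr smult_r_distr smult_assoc subset_iff)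
qed

text \<open>Turns simplicity of a submodule into a statement about submodules of \<open>M\<close>
  itself, where intersections can be formed.\<close>

lemma submodule_restrict:
  assumes "submodule H R M"
  shows "submodule K R (M\<lparr>carrier := H\<rparr>) \<longleftrightarrow> K \<subseteq> H \<and> submodule K R M"
proof -
  interpret H: left_module R "M\<lparr>carrier := H\<rparr>" by (rule submodule_left_module) fact
  note Hm = submoduleD[OF assms]
  show ?thesis
  proof
    assume "submodule K R (M\<lparr>carrier := H\<rparr>)"
    from H.submoduleD[OF this] Hm show "K \<subseteq> H \<and> submodule K R M"
      by (auto intro!: submoduleI)
  next
    assume K: "K \<subseteq> H \<and> submodule K R M"
    with submoduleD[of K] show "submodule K R (M\<lparr>carrier := H\<rparr>)"
      by (intro H.submoduleI) auto
  qed
qed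

lemma submodule_finite_sums:
  assumes "\<And>i. i \<in> I \<Longrightarrow> submodule (N i) R M"
  shows "submodule (finite_sums M I N) R M"
proof (rule submoduleI)
  note N = submoduleD[OF assms]
  show "finite_sums M I N \<subseteq> carrier M"
    using N(1) by (auto simp: finite_sums_def Pi_iff subset_iff intro!: M.finsum_closed)
  show zero: "\<zero>\<^bsub>M\<^esub> \<in> finite_sums M I N"
    unfolding finite_sums_def by (intro CollectI exI[of _ undefined] exI[of _ "{}"]) auto
  show add: "x \<oplus>\<^bsub>M\<^esub> y \<in> finite_sums M I N" if "x \<in> finite_sums M I N" "y \<in> finite_sums M I N" for x y
    using that by (intro M.finite_sums_add N(6)) auto
  show "a \<odot>\<^bsub>M\<^esub> x \<in> finite_sums M I N" if "a \<in> carrier R" "x \<in> finite_sums M I N" for a x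
    proof (rule M.finite_sums_map[where h = "\<lambda>x. a \<odot>\<^bsub>M\<^esub> x", OF N(1)])
    show "a \<odot>\<^bsub>M\<^esub> y \<in> finite_sums M I N" if "i \<in> I" "y \<in> N i" for i y
      using \<open>i \<in> I\<close> N(5)[OF \<open>i \<in> I\<close> \<open>a \<in> carrier R\<close> \<open>y \<in> N i\<close>] N(1)[OF \<open>i \<in> I\<close>]
      by (rule M.finite_sums_incl)
  qed (use that zero add in \<open>auto simp: smult_r_distr\<close>)
qed

end

section \<open>Extracting a direct sum from a sum of simple submodules\<close>

lemma Union_chain_independent:
  assumes "subset.chain {\<S>. \<S> \<subseteq> \<A> \<and> independent_family M \<S> N} \<C>"
  shows "independent_family M (\<Union>\<C>) N"
  unfolding independent_family_def
proof (intro allI impI, elim conjE)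
  fix F v assume F: "finite F" "F \<subseteq> \<Union>\<C>" "v \<in> Pi F N" "finsum M v F = \<zero>\<^bsub>M\<^esub>"
  show "\<forall>i\<in>F. v i = \<zero>\<^bsub>M\<^esub>"
  proof (cases "\<C> = {}")
    case False
    \<comment> \<open>A relation involves only finitely many members, and these already lie in one
      link of the chain. The empty chain has empty union and so an empty \<open>F\<close>.\<close>
    then obtain B where "B \<in> \<C>" "F \<subseteq> B"
      using finite_subset_Union_chain[OF F(1,2)] assms by metis
    with F assms show ?thesis
      unfolding subset_chain_def independent_family_def by blast
  qed (use F in auto)
qed

text \<open>Zorn's lemma gives a maximal independent subset \<open>\<S>\<close> of
  \<open>\<A>\<close>. A simple \<open>T\<close> either lies in the sum \<open>L\<close> of
  \<open>\<S>\<close> or meets it in zero; in the second case \<open>T\<close> could be adjoined.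
  The hypothesis \<open>gen\<close> expresses that the members of \<open>\<A>\<close> sum to
  \<open>M\<close> without mentioning sums.\<close>

lemma direct_sum_of_simplesI:
  fixes M :: "('a, 'm) module"
  assumes "left_module R M"
    and \<A>: "\<And>N. N \<in> \<A> \<Longrightarrow>
      submodule N R M \<and> simple_module R (M\<lparr>carrier := N\<rparr>) \<and> C (M\<lparr>carrier := N\<rparr>)"
    and gen: "\<And>L. \<lbrakk>submodule L R M; \<And>N. N \<in> \<A> \<Longrightarrow> N \<subseteq> L\<rbrakk> \<Longrightarrow> carrier M \<subseteq> L"
  shows "direct_sum_of_simples R C M"
proof -
  interpret left_module R M by fact
  note sub = submoduleD[OF conjunct1[OF \<A>]]
  let ?Z = "{\<S>. \<S> \<subseteq> \<A> \<and> independent_family M \<S> (\<lambda>N. N)}"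
  have "\<exists>\<S>\<in>?Z. \<forall>X\<in>?Z. \<S> \<subseteq> X \<longrightarrow> X = \<S>"
  proof (rule subset_Zorn')
    fix \<C> assume "subset.chain ?Z \<C>"
    with Union_chain_independent[OF this] show "\<Union>\<C> \<in> ?Z"
      by (auto simp: subset_chain_def)
  qed
  then obtain \<S> where \<S>: "\<S> \<subseteq> \<A>" "independent_family M \<S> (\<lambda>N. N)"
    and max: "\<forall>X\<in>?Z. \<S> \<subseteq> X \<longrightarrow> X = \<S>"
    by auto
  define L where "L = finite_sums M \<S> (\<lambda>N. N)"
  have L: "submodule L R M"
    unfolding L_def using \<S>(1) \<A> by (intro submodule_finite_sums) blast
  note Lm = submoduleD[OF L]
  have "T \<subseteq> L" if T: "T \<in> \<A>" for T
  proof (rule ccontr)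
    assume nL: "\<not> T \<subseteq> L"
    have "submodule (T \<inter> L) R (M\<lparr>carrier := T\<rparr>)"
      using \<A>[OF T] L submodule_restrict submodule_Int by auto
    then have TL: "T \<inter> L = {\<zero>\<^bsub>M\<^esub>}"
      using \<A>[OF T] nL by (auto simp: simple_module_def)
    \<comment> \<open>Ensures that \<open>insert T \<S>\<close> is a proper enlargement, so that its
      independence contradicts maximality.\<close>
    have TS: "T \<notin> \<S>"
    proof
      assume "T \<in> \<S>"
      then have "x \<in> L" if "x \<in> T" for x
        unfolding L_def using that sub(1)[OF T] by (intro M.finite_sums_incl[of T]) auto
      with nL show False by blast
    qed
    have "independent_family M (insert T \<S>) (\<lambda>N. N)"
      unfolding independent_family_def
    proof (intro allI impI, elim conjE)
      fix F v assume F: "finite F" "F \<subseteq> insert T \<S>" "v \<in> Pi F (\<lambda>N. N)" "finsum M v F = \<zero>\<^bsub>M\<^esub>"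
      define F' where "F' = F - {T}"
      have F': "finite F'" "F' \<subseteq> \<S>" "v \<in> Pi F' (\<lambda>N. N)" "T \<notin> F'"
        using F by (auto simp: F'_def)
      have vc: "v N \<in> carrier M" if "N \<in> F" for N
        using that F \<S>(1) T sub(1) by (fastforce simp: Pi_iff)
      have sL: "finsum M v F' \<in> L" and sc: "finsum M v F' \<in> carrier M"
        using F' Lm(1) unfolding L_def finite_sums_def by blast+
      \<comment> \<open>In a vanishing sum the term from \<open>T\<close> is minus the sum of the
        others, which lies in \<open>L\<close>; so it lies in \<open>T \<inter> L\<close>, which is
        zero. What remains is a relation within \<open>\<S>\<close>.\<close>
      have vT: "v T = \<zero>\<^bsub>M\<^esub>" if "T \<in> F"
      proof -
        have "F = insert T F'" using that by (auto simp: F'_def)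
        then have "v T \<oplus>\<^bsub>M\<^esub> finsum M v F' = \<zero>\<^bsub>M\<^esub>"
          using F F' vc by (auto simp: M.finsum_insert Pi_iff)
        then have "v T = \<ominus>\<^bsub>M\<^esub> finsum M v F'"
          using sc vc[OF that] by (simp add: M.minus_equality)
        then have "v T \<in> T \<inter> L"
          using Lm(3)[OF sL] Pi_mem[OF F(3) that] by simp
        then show ?thesis using TL by auto
      qed
      have "finsum M v F' = finsum M v F"
        by (rule M.add.finprod_mono_neutral_cong_left) (use F vT vc in \<open>auto simp: F'_def\<close>)
      then have "\<forall>i\<in>F'. v i = \<zero>\<^bsub>M\<^esub>"
        using F(4) F' \<S>(2) unfolding independent_family_def by metis
      then show "\<forall>i\<in>F. v i = \<zero>\<^bsub>M\<^esub>"
        using vT by (auto simp: F'_def)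
    qed
    then show False
      using max[rule_format, of "insert T \<S>"] \<S>(1) T TS by auto
  qed
  then have "carrier M \<subseteq> finite_sums M \<S> (\<lambda>N. N)"
    using gen[OF L] by (simp add: L_def)
  then have "internal_direct_sum M \<S> (\<lambda>N. N)"
    using \<S> sub(6) by (intro internal_direct_sumI) (auto simp: M.abelian_group_axioms)
  then show ?thesis
    unfolding direct_sum_of_simples_def using \<S>(1) \<A> by blast
qed

section \<open>Relations between the operators\<close>

lemma End_ring_compose: "\<lbrakk>f \<in> carrier End_ring; g \<in> carrier End_ring\<rbrakk> \<Longrightarrow> f \<circ> g \<in> carrier End_ring"
  by (auto simp: End_ring_def linear_scalar_iff)

lemma End_ring_plus:
  "\<lbrakk>f \<in> carrier End_ring; g \<in> carrier End_ring\<rbrakk> \<Longrightarrow> (\<lambda>p. f p + g p) \<in> carrier End_ring"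
  by (auto simp: End_ring_def linear_scalar_iff scalar.scale_right_distrib add_ac)

lemma End_ring_id: "id \<in> carrier End_ring" "(\<lambda>p. p) \<in> carrier End_ring"
  by (auto simp: End_ring_def linear_scalar_iff)

lemma linear_H_op: "H_op i \<in> carrier End_ring"
  unfolding H_op_def by (intro End_ring_compose linear_deriv_op linear_mult_op)

lemmas End_ring_intros = End_ring_compose End_ring_plus End_ring_id linear_scalar_op linear_mult_op
  linear_deriv_op linear_integ_op linear_H_op

text \<open>Every polynomial arises from zero by adding monomials with new exponents, and both
  operators are additive. Relations between operators thereby become arithmetic with exponents and
  coefficients.\<close>

lemma operator_eqI:
  assumes f: "f \<in> carrier End_ring" and g: "g \<in> carrier End_ring"
    and single: "\<And>\<alpha> c. f (Poly_Mapping.single \<alpha> c) = g (Poly_Mapping.single \<alpha> c)"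
  shows "f = g"
proof
  fix p
  have add: "f (p + q) = f p + f q" "g (p + q) = g p + g q" for p q
    using f g by (auto simp: End_ring_def linear_scalar_iff)
  show "f p = g p"
  proof (induction p rule: Poly_Mapping.update_induct)
    case const
    show ?case using add[of 0 0] by simp
  next
    case (update p \<alpha> c)
    have "Poly_Mapping.update \<alpha> c p = Poly_Mapping.single \<alpha> c + p"
      using update(1) by (intro poly_mapping_eqI)
        (auto simp: lookup_update lookup_add lookup_single when_def in_keys_iff)
    with update show ?case by (simp add: add single)
  qed
qed

lemma operator_zero: "f \<in> carrier End_ring \<Longrightarrow> f 0 = 0"
  by (simp add: End_ring_def linear_scalar_iff) (metis add_cancel_right_right)

lemma H_op_single:
  "H_op i (Poly_Mapping.single \<alpha> c) = Poly_Mapping.single \<alpha> ((of_nat (Poly_Mapping.lookup \<alpha> i) + 1) * c)"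
  by (simp add: H_op_def mult_op_single deriv_op_single lookup_add add_ac)

lemmas op_single = mult_op_single deriv_op_single integ_op_single H_op_single

text \<open>Subtraction of exponents is truncated at zero: two subtractions always commute, but a
  subtraction and an addition in the same variable do not at exponent zero.\<close>

lemma exponent_diff_commute:
  fixes \<alpha> :: "'n \<Rightarrow>\<^sub>0 nat"
  shows "\<alpha> - Poly_Mapping.single i 1 - Poly_Mapping.single j 1 =
      \<alpha> - Poly_Mapping.single j 1 - Poly_Mapping.single i 1"
    "i \<noteq> j \<Longrightarrow> \<alpha> + Poly_Mapping.single j 1 - Poly_Mapping.single i 1 =
      \<alpha> - Poly_Mapping.single i 1 + Poly_Mapping.single j 1"
    "Poly_Mapping.lookup \<alpha> i \<noteq> 0 \<Longrightarrow> \<alpha> - Poly_Mapping.single i 1 + Poly_Mapping.single i 1 = \<alpha>"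
  by (auto intro!: poly_mapping_eqI simp: lookup_add lookup_minus lookup_single when_def)

lemma deriv_integ: "deriv_op i \<circ> integ_op i = id"
  by (intro operator_eqI End_ring_intros)
    (simp add: op_single lookup_add field_simps del: of_nat_add of_nat_Suc)

lemma deriv_deriv: "deriv_op i \<circ> deriv_op j = deriv_op j \<circ> deriv_op i"
  by (cases "i = j", simp, intro operator_eqI End_ring_intros)
    (simp add: op_single lookup_minus lookup_single exponent_diff_commute(1)[of _ i j] mult.left_commute
      del: One_nat_def)

lemma integ_integ: "integ_op i \<circ> integ_op j = integ_op j \<circ> integ_op i"
  by (cases "i = j", simp, intro operator_eqI End_ring_intros)
    (simp add: op_single lookup_add lookup_single add_ac mult.commute)

lemma deriv_integ_commute: "i \<noteq> j \<Longrightarrow> deriv_op i \<circ> integ_op j = integ_op j \<circ> deriv_op i"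
  by (intro operator_eqI End_ring_intros)
    (simp add: op_single lookup_add lookup_minus lookup_single exponent_diff_commute(2)
      del: One_nat_def)

lemma H_deriv: "i \<noteq> j \<Longrightarrow> H_op i \<circ> deriv_op j = deriv_op j \<circ> H_op i"
  by (intro operator_eqI End_ring_intros)
    (simp add: op_single lookup_minus lookup_single mult.left_commute)

lemma H_integ: "i \<noteq> j \<Longrightarrow> H_op i \<circ> integ_op j = integ_op j \<circ> H_op i"
  by (intro operator_eqI End_ring_intros) (simp add: op_single lookup_add lookup_single)

text \<open>This commutation rule makes \<open>deriv_op i\<close> lower weights by one; its
  counterpart \<open>H_integ_same\<close> makes \<open>integ_op i\<close> raise them.\<close>

lemma deriv_H: "deriv_op i \<circ> H_op i = (\<lambda>p. (H_op i \<circ> deriv_op i) p + deriv_op i p)"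
proof (intro operator_eqI End_ring_intros)
  fix \<alpha> :: "'a \<Rightarrow>\<^sub>0 nat" and c :: 'b
  show "(deriv_op i \<circ> H_op i) (Poly_Mapping.single \<alpha> c) =
    (H_op i \<circ> deriv_op i) (Poly_Mapping.single \<alpha> c) + deriv_op i (Poly_Mapping.single \<alpha> c)"
    \<comment> \<open>At exponent zero the derivative vanishes; otherwise the truncated subtraction
      is a true one.\<close>
    by (cases "Poly_Mapping.lookup \<alpha> i")
      (simp_all add: op_single operator_zero linear_H_op lookup_minus algebra_simps flip: single_add)
qed

lemma H_integ_same: "H_op i \<circ> integ_op i = (\<lambda>p. (integ_op i \<circ> H_op i) p + integ_op i p)"
  by (intro operator_eqI End_ring_intros)
    (simp add: op_single lookup_add algebra_simps add_divide_distrib flip: single_add)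

text \<open>On a monomial \<open>H_op i\<close> contributes the exponent plus one as a factor,
  nonzero in characteristic zero, and integration divides it out again. Closure under
  multiplications thus follows from closure under \<open>integ_op\<close> and
  \<open>H_op\<close>.\<close>

lemma mult_op_eq: "mult_op i = integ_op i \<circ> H_op i"
proof (intro operator_eqI End_ring_intros)
  fix \<alpha> :: "'a \<Rightarrow>\<^sub>0 nat" and c :: 'b
  have "of_nat (Poly_Mapping.lookup \<alpha> i) + 1 \<noteq> (0::'b)"
    by (metis of_nat_Suc of_nat_eq_0_iff add.commute nat.distinct(1))
  then show "mult_op i (Poly_Mapping.single \<alpha> c) = (integ_op i \<circ> H_op i) (Poly_Mapping.single \<alpha> c)"
    by (simp add: op_single add.commute)
qed

text \<open>With \<open>e\<^sub>i = 1 - \<integral>\<^sub>i \<partial>\<^sub>i\<close> the next relation reads \<open>H\<^sub>i e\<^sub>i = e\<^sub>i\<close>.\<close>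

lemma H_idempotent:
  "(\<lambda>p. H_op i p + (integ_op i \<circ> deriv_op i) p) = (\<lambda>p. p + (H_op i \<circ> (integ_op i \<circ> deriv_op i)) p)"
proof (intro operator_eqI End_ring_intros)
  fix \<alpha> :: "'a \<Rightarrow>\<^sub>0 nat" and c :: 'b
  show "H_op i (Poly_Mapping.single \<alpha> c) + (integ_op i \<circ> deriv_op i) (Poly_Mapping.single \<alpha> c) =
    Poly_Mapping.single \<alpha> c + (H_op i \<circ> (integ_op i \<circ> deriv_op i)) (Poly_Mapping.single \<alpha> c)"
  \<comment> \<open>At exponent zero \<open>deriv_op i\<close> kills the monomial and
    \<open>H_op i\<close> fixes it; at positive exponent
    \<open>integ_op i \<circ> deriv_op i\<close> fixes it.\<close>
  proof (cases "Poly_Mapping.lookup \<alpha> i")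
    case 0
    then show ?thesis by (simp add: op_single operator_zero linear_H_op linear_integ_op)
  next
    case (Suc k)
    moreover have "of_nat k + (1::'b) \<noteq> 0"
      by (metis of_nat_Suc of_nat_eq_0_iff add.commute nat.distinct(1))
    ultimately have "(integ_op i \<circ> deriv_op i) (Poly_Mapping.single \<alpha> c) = Poly_Mapping.single \<alpha> c"
      by (simp add: op_single lookup_minus exponent_diff_commute(3)[of \<alpha> i] add.commute[of 1] del: One_nat_def)
    then show ?thesis by (simp add: add.commute)
  qed
qed

section \<open>Membership in the algebra and the projection onto the kernel of a derivation\<close>

lemma scalar_commute: "f \<in> carrier End_ring \<Longrightarrow> f \<circ> scalar_op c = scalar_op c \<circ> f"
  by (auto simp: End_ring_def linear_scalar_iff)

lemma IDO_sub_End: "carrier IDO \<subseteq> carrier End_ring"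
proof -
  have "generate_ring End_ring (range scalar_op \<union> range mult_op \<union> range deriv_op \<union> range integ_op)
      \<subseteq> (carrier End_ring :: ('a, 'b) mpoly_op set)"
    by (rule ring.generate_ring_incl[OF ring_End_ring])
      (auto intro: linear_scalar_op linear_mult_op linear_deriv_op linear_integ_op)
  then show ?thesis by (simp add: IDO_def)
qed

lemma IDO_generators:
  "scalar_op c \<in> carrier IDO" "mult_op i \<in> carrier IDO" "deriv_op i \<in> carrier IDO"
  "integ_op i \<in> carrier IDO"
  by (auto simp: IDO_def intro: generate_ring.incl)

lemma IDO_ops: "mult IDO = (\<circ>)" "add IDO = (\<lambda>f g p. f p + g p)" "one IDO = id" "zero IDO = (\<lambda>_. 0)"
  by (simp_all add: IDO_def End_ring_def)

lemma IDO_compose: "\<lbrakk>f \<in> carrier IDO; g \<in> carrier IDO\<rbrakk> \<Longrightarrow> f \<circ> g \<in> carrier IDO"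
  using monoid.m_closed[OF ring.is_monoid[OF ring_IDO]] by (simp add: IDO_ops)

lemma IDO_plus: "\<lbrakk>f \<in> carrier IDO; g \<in> carrier IDO\<rbrakk> \<Longrightarrow> (\<lambda>p. f p + g p) \<in> carrier IDO"
  using abelian_groupE(1)[OF ring.is_abelian_group[OF ring_IDO]] by (simp add: IDO_ops)

lemma IDO_id: "id \<in> carrier IDO" "(\<lambda>p. p) \<in> carrier IDO"
  using monoid.one_closed[OF ring.is_monoid[OF ring_IDO]] by (simp_all add: IDO_ops id_def)

lemma IDO_H: "H_op i \<in> carrier IDO"
  unfolding H_op_def by (intro IDO_compose IDO_generators)

lemmas IDO_intros = IDO_compose IDO_plus IDO_id IDO_generators IDO_H

lemma funpow_IDO: "f \<in> carrier IDO \<Longrightarrow> f ^^ n \<in> carrier IDO"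
  by (induction n) (auto intro: IDO_intros)

text \<open>Negation is a separate closure rule of \<open>generate_ring\<close>; written as a scalar
  multiple, it is handled by the scalar action.\<close>

lemma IDO_minus:
  fixes f :: "('n::finite, 'k::field_char_0) mpoly_op"
  assumes "f \<in> carrier End_ring"
  shows "\<ominus>\<^bsub>End_ring\<^esub> f = scalar_op (- 1) \<circ> f"
proof (rule abelian_group.minus_equality[OF ring.is_abelian_group[OF ring_End_ring]])
  show "(scalar_op (- 1) \<circ> f) \<oplus>\<^bsub>End_ring\<^esub> f = \<zero>\<^bsub>End_ring\<^esub>"
    by (auto simp: End_ring_def)
qed (auto intro: assms End_ring_intros)

text \<open>The difference \<open>1 - integ_op i \<circ> deriv_op i\<close> is encoded through the
  scalar \<open>-1\<close>, so that membership in \<open>IDO\<close> and the action follow from the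
  rules for sums and composites.\<close>

definition kernel_proj :: "'n \<Rightarrow> ('n::finite, 'k::field_char_0) mpoly_op" where
  "kernel_proj i = (\<lambda>p. p + (scalar_op (- 1) \<circ> (integ_op i \<circ> deriv_op i)) p)"

lemma kernel_proj_IDO: "kernel_proj i \<in> carrier IDO"
  unfolding kernel_proj_def by (intro IDO_intros)

text \<open>Serves for \<open>f\<close> a derivation or integration in another variable: projecting
  in direction \<open>i\<close> then preserves purity in the other directions.\<close>

lemma kernel_proj_commute:
  assumes f: "f \<in> carrier End_ring" and c: "f \<circ> deriv_op i = deriv_op i \<circ> f" "f \<circ> integ_op i = integ_op i \<circ> f"
  shows "kernel_proj i \<circ> f = f \<circ> kernel_proj i"
proof
  fix p
  have add: "f (p + q) = f p + f q" and scale: "f (scalar_op c p) = scalar_op c (f p)" for p q c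
    using f by (auto simp: End_ring_def linear_scalar_iff)
  have "f (integ_op i (deriv_op i p)) = integ_op i (deriv_op i (f p))"
    using c by (metis comp_apply)
  then show "(kernel_proj i \<circ> f) p = (f \<circ> kernel_proj i) p"
    by (simp only: kernel_proj_def comp_apply add scale)
qed

section \<open>Integer powers and shifts\<close>

text \<open>As \<open>deriv_op i \<circ> integ_op i = id\<close> but not conversely, this is no
  homomorphism in \<open>k\<close>: derivation lowers \<open>k\<close> always, while integration
  raises it, as an operator, only for \<open>k \<ge> 0\<close>.\<close>

definition int_shift :: "'n \<Rightarrow> int \<Rightarrow> ('n::finite, 'k::field_char_0) mpoly_op" where
  "int_shift i k = (if k \<ge> 0 then integ_op i ^^ nat k else deriv_op i ^^ nat (- k))"

text \<open>The fold is independent of the order because shifts in distinct variables commute.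
  Subsets \<open>S\<close> allow one direction to be split off.\<close>

definition multi_shift :: "'n set \<Rightarrow> ('n \<Rightarrow> int) \<Rightarrow> ('n::finite, 'k::field_char_0) mpoly_op" where
  "multi_shift S z = Finite_Set.fold (\<lambda>i f. int_shift i (z i) \<circ> f) id S"

lemma int_shift_0: "int_shift i 0 = id"
  by (simp add: int_shift_def)

lemma int_shift_IDO: "int_shift i k \<in> carrier IDO"
  by (auto simp: int_shift_def intro: funpow_IDO IDO_generators)

text \<open>For positive \<open>k\<close> the derivation cancels one integration by
  \<open>deriv_integ\<close>; otherwise it adds one more derivation.\<close>

lemma deriv_int_shift: "deriv_op i \<circ> int_shift i k = int_shift i (k - 1)"
proof (cases "k > 0")
  case True
  then have "nat k = Suc (nat (k - 1))" by simp
  then have "deriv_op i \<circ> int_shift i k = (deriv_op i \<circ> integ_op i) \<circ> integ_op i ^^ nat (k - 1)"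
    using True by (simp add: int_shift_def o_assoc)
  with True show ?thesis by (simp add: deriv_integ int_shift_def)
next
  case False
  then have "nat (- (k - 1)) = Suc (nat (- k))" by simp
  with False show ?thesis by (auto simp: int_shift_def)
qed

text \<open>A derivation is moved to the right end, next to the vector acted on. Hence a vector
  killed by \<open>deriv_op i\<close> is killed by all negative shifts in direction
  \<open>i\<close>.\<close>

lemma int_shift_neg: "k < 0 \<Longrightarrow> int_shift i k = int_shift i (k + 1) \<circ> deriv_op i"
proof -
  assume k: "k < 0"
  then have "nat (- k) = Suc (nat (- (k + 1)))" by simp
  then show ?thesis using k
    \<comment> \<open>At \<open>k = -1\<close> the shift by \<open>k + 1\<close> falls under the
      nonnegative branch of the definition.\<close>
    by (cases "k + 1 = 0") (simp_all add: int_shift_def funpow_Suc_right del: funpow.simps(2))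
qed

lemma integ_int_shift: "k \<ge> 0 \<Longrightarrow> integ_op i \<circ> int_shift i k = int_shift i (k + 1)"
  by (simp add: int_shift_def nat_add_distrib)

lemma funpow_commute_op: "f \<circ> g = g \<circ> f \<Longrightarrow> f \<circ> (g ^^ n) = (g ^^ n) \<circ> f"
  by (induction n) (simp_all add: fun_eq_iff)

lemma int_shift_commute_op:
  fixes f :: "('n::finite, 'k::field_char_0) mpoly_op"
  shows "\<lbrakk>f \<circ> deriv_op i = deriv_op i \<circ> f; f \<circ> integ_op i = integ_op i \<circ> f\<rbrakk> \<Longrightarrow>
    f \<circ> int_shift i k = int_shift i k \<circ> f"
  unfolding int_shift_def by (simp add: funpow_commute_op)

lemma deriv_int_shift_commute: "i \<noteq> j \<Longrightarrow> deriv_op i \<circ> int_shift j k = int_shift j k \<circ> deriv_op i"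
  by (intro int_shift_commute_op deriv_deriv deriv_integ_commute)

lemma integ_int_shift_commute: "i \<noteq> j \<Longrightarrow> integ_op i \<circ> int_shift j k = int_shift j k \<circ> integ_op i"
  by (intro int_shift_commute_op integ_integ deriv_integ_commute[symmetric]) auto

lemma int_shift_int_shift: "int_shift i k \<circ> int_shift j l = int_shift j l \<circ> int_shift i k" if "i \<noteq> j"
  using that by (intro int_shift_commute_op[of "int_shift i k"])
    (simp_all add: deriv_int_shift_commute integ_int_shift_commute)

lemma comp_fun_commute_multi_shift:
  "comp_fun_commute (\<lambda>i (f :: ('n::finite, 'k::field_char_0) mpoly_op). int_shift i (z i) \<circ> f)"
proof
  fix i j
  have compose: "(\<circ>) f \<circ> (\<circ>) g = (\<circ>) (f \<circ> g)" for f g :: "('n, 'k) mpoly_op"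
    by (simp add: fun_eq_iff)
  show "(\<circ>) (int_shift j (z j)) \<circ> (\<circ>) (int_shift i (z i)) =
      ((\<circ>) (int_shift i (z i)) \<circ> (\<circ>) (int_shift j (z j)) :: ('n, 'k) mpoly_op \<Rightarrow> _)"
  proof (cases "i = j")
    case False
    then show ?thesis
      unfolding compose by (intro arg_cong[where f = "(\<circ>)"] int_shift_int_shift) simp
  qed simp
qed

lemma multi_shift_empty: "multi_shift {} z = id"
  by (simp add: multi_shift_def)

lemma multi_shift_insert:
  assumes "i \<notin> S"
  shows "(multi_shift (insert i S) z :: ('n::finite, 'k::field_char_0) mpoly_op) =
    int_shift i (z i) \<circ> multi_shift S z"
proof -
  interpret comp_fun_commute "\<lambda>i (f :: ('n, 'k) mpoly_op). int_shift i (z i) \<circ> f"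
    by (rule comp_fun_commute_multi_shift)
  show ?thesis using assms by (simp add: multi_shift_def)
qed

lemma multi_shift_cong: "(\<And>i. i \<in> S \<Longrightarrow> z i = z' i) \<Longrightarrow> multi_shift S z = multi_shift S z'"
  using finite[of S] by (induction S rule: finite_induct) (simp_all add: multi_shift_empty multi_shift_insert)

lemma multi_shift_IDO: "multi_shift S z \<in> carrier IDO"
  using finite[of S]
proof (induction S rule: finite_induct)
  case (insert i S)
  show ?case unfolding multi_shift_insert[OF insert(2)] by (intro IDO_compose int_shift_IDO insert)
qed (simp add: multi_shift_empty IDO_id)

lemma multi_shift_commute_op:
  fixes f :: "('n::finite, 'k::field_char_0) mpoly_op"
  assumes "\<And>j k. j \<in> S \<Longrightarrow> f \<circ> int_shift j k = int_shift j k \<circ> f"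
  shows "f \<circ> multi_shift S z = multi_shift S z \<circ> f"
  using finite[of S] assms
proof (induction S rule: finite_induct)
  case (insert j S)
  then have "f \<circ> int_shift j (z j) = int_shift j (z j) \<circ> f" "f \<circ> multi_shift S z = multi_shift S z \<circ> f"
    by blast+
  then show ?case
    unfolding multi_shift_insert[OF insert(2)] by (metis comp_assoc)
qed (simp add: multi_shift_empty)

lemma multi_shift_zero: "multi_shift S (\<lambda>_. 0) = id"
  using finite[of S] by (induction S rule: finite_induct)
    (simp_all add: multi_shift_empty multi_shift_insert int_shift_0)

text \<open>Isolates direction \<open>i\<close> at either end of the product, with a remainder that
  does not see \<open>z i\<close>. Every full shift has this form, because
  \<open>z = z(i := z i)\<close>.\<close>

lemma multi_shift_update:
  "multi_shift UNIV (z(i := k)) = int_shift i k \<circ> multi_shift (- {i}) z"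
  "multi_shift UNIV (z(i := k)) = multi_shift (- {i}) z \<circ> int_shift i k"
proof -
  have "multi_shift UNIV (z(i := k)) = multi_shift (insert i (- {i})) (z(i := k))"
    by (rule arg_cong2[where f = multi_shift]) auto
  also have "\<dots> = int_shift i k \<circ> multi_shift (- {i}) (z(i := k))"
    by (subst multi_shift_insert) auto
  also have "multi_shift (- {i}) (z(i := k)) = multi_shift (- {i}) z"
    by (rule multi_shift_cong) auto
  finally show 1: "multi_shift UNIV (z(i := k)) = int_shift i k \<circ> multi_shift (- {i}) z" .
  show "multi_shift UNIV (z(i := k)) = multi_shift (- {i}) z \<circ> int_shift i k"
    unfolding 1 by (rule multi_shift_commute_op) (auto intro: int_shift_int_shift)
qed

lemma multi_shift_commute:
  "i \<notin> S \<Longrightarrow> deriv_op i \<circ> multi_shift S z = multi_shift S z \<circ> deriv_op i"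
  "i \<notin> S \<Longrightarrow> integ_op i \<circ> multi_shift S z = multi_shift S z \<circ> integ_op i"
   apply (rule multi_shift_commute_op, rule deriv_int_shift_commute, blast)
  apply (rule multi_shift_commute_op, rule integ_int_shift_commute, blast)
  done

section \<open>Weight vectors\<close>

locale ido_module = left_module IDO M
  for M :: "(('n::finite, 'k::field_char_0) mpoly_op, 'm) module" (structure)
begin

section \<open>The action of operators on vectors\<close>

lemma act_comp:
  "\<lbrakk>f \<in> carrier IDO; g \<in> carrier IDO; v \<in> carrier M\<rbrakk> \<Longrightarrow> (f \<circ> g) \<odot> v = f \<odot> (g \<odot> v)"
  using smult_assoc[of f g v] by (simp add: IDO_ops)

lemma act_plus:
  "\<lbrakk>f \<in> carrier IDO; g \<in> carrier IDO; v \<in> carrier M\<rbrakk> \<Longrightarrow> (\<lambda>p. f p + g p) \<odot> v = f \<odot> v \<oplus> g \<odot> v"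
  using smult_l_distr[of f g v] by (simp add: IDO_ops)

lemma act_id: "v \<in> carrier M \<Longrightarrow> id \<odot> v = v" "v \<in> carrier M \<Longrightarrow> (\<lambda>p. p) \<odot> v = v"
  using smult_one[of v] by (simp_all add: IDO_ops id_def)

lemma act_eq:
  "\<lbrakk>f \<circ> g = f' \<circ> g'; f \<in> carrier IDO; g \<in> carrier IDO; f' \<in> carrier IDO; g' \<in> carrier IDO; v \<in> carrier M\<rbrakk>
    \<Longrightarrow> f \<odot> (g \<odot> v) = f' \<odot> (g' \<odot> v)"
  by (metis act_comp)

lemma act_scalar_commute:
  assumes "f \<in> carrier IDO" "v \<in> carrier M"
  shows "f \<odot> (scalar_op c \<odot> v) = scalar_op c \<odot> (f \<odot> v)"
  using assms IDO_sub_End by (intro act_eq scalar_commute IDO_intros) auto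

lemma act_scalar_scalar: "v \<in> carrier M \<Longrightarrow> scalar_op a \<odot> (scalar_op b \<odot> v) = scalar_op (a * b) \<odot> v"
  by (subst act_comp[symmetric]) (auto simp: IDO_intros comp_def)

lemma act_scalar_add: "v \<in> carrier M \<Longrightarrow> scalar_op (a + b) \<odot> v = scalar_op a \<odot> v \<oplus> scalar_op b \<odot> v"
  by (subst act_plus[symmetric]) (auto simp: IDO_intros scalar.scale_left_distrib fun_eq_iff intro!: arg_cong2[where f = "(\<odot>)"])

lemma act_scalar_one: "v \<in> carrier M \<Longrightarrow> scalar_op 1 \<odot> v = v"
  using act_id(2)[of v] scalar.scale_one by (metis ext)

lemma act_scalar_zero: "v \<in> carrier M \<Longrightarrow> scalar_op 0 \<odot> v = \<zero>"
  using act_scalar_add[of v 0 0] by (simp add: IDO_intros)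

lemma act_scalar_minus: "v \<in> carrier M \<Longrightarrow> scalar_op (- 1) \<odot> v = \<ominus> v"
  using act_scalar_add[of v "- 1" 1]
  by (intro minus_equality[symmetric]) (auto simp: IDO_intros act_scalar_one act_scalar_zero)

lemma scalar_cancel:
  assumes "submodule K IDO M" "c \<noteq> 0" "v \<in> carrier M" "scalar_op c \<odot> v \<in> K"
  shows "v \<in> K"
proof -
  have "scalar_op (inverse c) \<odot> (scalar_op c \<odot> v) \<in> K"
    by (rule submoduleD(5)[OF assms(1) IDO_generators(1) assms(4)])
  moreover have "scalar_op (inverse c) \<odot> (scalar_op c \<odot> v) = v"
    using assms(2,3) by (simp add: act_scalar_scalar act_scalar_one)
  ultimately show ?thesis by metis
qed

lemma submodule_zero: "submodule {\<zero>} IDO M"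
  by (rule submoduleI) auto

text \<open>Induction over the generated ring reduces the test to generators, and
  \<open>mult_op i\<close> is \<open>integ_op i \<circ> H_op i\<close>. Testing \<open>H_op\<close>
  suits sets built from weight vectors, which it merely rescales.\<close>

lemma submodule_IDO_I:
  assumes K: "K \<subseteq> carrier M" "\<zero> \<in> K" "\<And>x y. \<lbrakk>x \<in> K; y \<in> K\<rbrakk> \<Longrightarrow> x \<oplus> y \<in> K"
    and scalar: "\<And>c x. x \<in> K \<Longrightarrow> scalar_op c \<odot> x \<in> K"
    and deriv: "\<And>i x. x \<in> K \<Longrightarrow> deriv_op i \<odot> x \<in> K"
    and integ: "\<And>i x. x \<in> K \<Longrightarrow> integ_op i \<odot> x \<in> K"
    and H: "\<And>i x. x \<in> K \<Longrightarrow> H_op i \<odot> x \<in> K"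
  shows "submodule K IDO M"
proof (rule submoduleI[OF K])
  let ?G = "range scalar_op \<union> range mult_op \<union> range deriv_op \<union> range integ_op :: ('n, 'k) mpoly_op set"
  fix f :: "('n, 'k) mpoly_op" and x assume "f \<in> carrier IDO" and x: "x \<in> K"
  then have "f \<in> generate_ring End_ring ?G" by (simp add: IDO_def)
  \<comment> \<open>Membership in \<open>IDO\<close> is carried through the induction, because the
    module laws for sums and composites require it.\<close>
  then have "f \<in> carrier IDO \<and> (\<forall>x\<in>K. f \<odot> x \<in> K)"
  proof induction
    case one
    then show ?case using K act_id by (auto simp: End_ring_def IDO_intros)
  next
    case (incl f)
    then show ?case
    proof (elim UnE)
      assume "f \<in> range mult_op"
      then obtain i where "f = mult_op i" by auto
      then have f: "f = integ_op i \<circ> H_op i" by (simp add: mult_op_eq)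
      have "f \<odot> x \<in> K" if "x \<in> K" for x
        unfolding f using that K(1) by (subst act_comp) (auto intro: IDO_intros integ H)
      moreover have "f \<in> carrier IDO" unfolding f by (intro IDO_intros)
      ultimately show ?thesis by blast
    qed (auto intro: IDO_intros scalar deriv integ)
  next
    case (a_inv f)
    then have eq: "\<ominus>\<^bsub>End_ring\<^esub> f = scalar_op (- 1) \<circ> f"
      using IDO_sub_End by (intro IDO_minus) auto
    show ?case
      unfolding eq
    proof (intro conjI ballI IDO_compose IDO_generators)
      fix x assume x: "x \<in> K"
      with a_inv K(1) have "(scalar_op (- 1) \<circ> f) \<odot> x = scalar_op (- 1) \<odot> (f \<odot> x)"
        by (intro act_comp IDO_generators) auto
      then show "(scalar_op (- 1) \<circ> f) \<odot> x \<in> K"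
        using a_inv scalar x by metis
    qed (use a_inv in blast)
  next
    case (eng_add f g)
    have eq: "f \<oplus>\<^bsub>End_ring\<^esub> g = (\<lambda>p. f p + g p)" by (simp add: End_ring_def)
    show ?case
      unfolding eq
    proof (intro conjI ballI IDO_plus)
      fix x assume x: "x \<in> K"
      with eng_add K(1) have "(\<lambda>p. f p + g p) \<odot> x = f \<odot> x \<oplus> g \<odot> x"
        by (intro act_plus) auto
      then show "(\<lambda>p. f p + g p) \<odot> x \<in> K"
        using eng_add K(3) x by metis
    qed (use eng_add in blast)+
  next
    case (eng_mult f g)
    have eq: "f \<otimes>\<^bsub>End_ring\<^esub> g = f \<circ> g" by (simp add: End_ring_def)
    show ?case
      unfolding eq
    proof (intro conjI ballI IDO_compose)
      fix x assume x: "x \<in> K"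
      with eng_mult K(1) have "(f \<circ> g) \<odot> x = f \<odot> (g \<odot> x)"
        by (intro act_comp) auto
      then show "(f \<circ> g) \<odot> x \<in> K"
        using eng_mult x by metis
    qed (use eng_mult in blast)+
  qed
  with x show "f \<odot> x \<in> K" by blast
qed

section \<open>Weight spaces and weight components\<close>

lemma weight_spaceD:
  assumes "v \<in> weight_space M \<mu>"
  shows "v \<in> carrier M" "H_op i \<odot> v = scalar_op (\<mu> i) \<odot> v"
  using assms by (auto simp: weight_space_def)

lemma weight_space_zero: "\<zero> \<in> weight_space M \<mu>"
  by (simp add: weight_space_def IDO_intros)

lemma weight_space_plus:
  assumes "v \<in> weight_space M \<mu>" "w \<in> weight_space M \<mu>"
  shows "v \<oplus> w \<in> weight_space M \<mu>"
  using assms by (simp add: weight_space_def smult_r_distr IDO_intros)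

lemma weight_space_scalar:
  assumes "v \<in> weight_space M \<mu>"
  shows "scalar_op c \<odot> v \<in> weight_space M \<mu>"
  using assms by (simp add: weight_space_def IDO_intros act_scalar_commute[of "H_op _"] act_scalar_scalar mult.commute)

lemma weight_space_subgroup: "subgroup (weight_space M \<mu>) (add_monoid M)"
proof -
  have "\<ominus> v \<in> weight_space M \<mu>" if "v \<in> weight_space M \<mu>" for v
    using weight_space_scalar[OF that, of "- 1"] weight_spaceD(1)[OF that] by (simp add: act_scalar_minus)
  then show ?thesis
    by (intro subgroup.intro)
      (auto simp: weight_space_zero weight_space_plus a_inv_def dest: weight_spaceD(1))
qed

text \<open>Eigenvalues separate distinct weights: applying \<open>H_op i - w y i\<close> removes
  the component at \<open>y\<close> and rescales the others, giving a shorter sum in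
  \<open>K\<close>. Indexing weights through an injective \<open>w\<close> also covers families
  indexed by integer vectors.\<close>

lemma weight_components:
  assumes K: "submodule K IDO M" and F: "finite F" "inj_on w F"
    and v: "\<And>z. z \<in> F \<Longrightarrow> v z \<in> weight_space M (w z)" and sum: "finsum M v F \<in> K"
  shows "\<forall>z\<in>F. v z \<in> K"
  using F v sum
proof (induction F arbitrary: v rule: finite_induct)
  case (insert y F)
  note Km = submoduleD[OF K]
  have vc: "v z \<in> carrier M" if "z \<in> insert y F" for z
    using insert.prems(2)[OF that] by (rule weight_spaceD(1))
  then have vF: "v \<in> F \<rightarrow> carrier M" and vy: "v y \<in> carrier M" and vyF: "v \<in> insert y F \<rightarrow> carrier M" by auto
  have vF_K: "v z \<in> K" if z: "z \<in> F" for z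
  proof -
    have "w z \<noteq> w y"
      using insert.prems(1) insert.hyps(2) z by (metis inj_onD insertI1 insertI2)
    \<comment> \<open>This \<open>i\<close> depends on \<open>z\<close>. The factor at other
      \<open>t\<close> may vanish, but the induction hypothesis is applied to the rescaled family,
      and the factor is cancelled at \<open>z\<close> only.\<close>
    then obtain i where i: "w z i \<noteq> w y i" by blast
    define f where "f = (\<lambda>p. H_op i p + scalar_op (- w y i) p)"
    have f: "f \<in> carrier IDO" unfolding f_def by (intro IDO_intros)
    have fv: "f \<odot> v t = scalar_op (w t i - w y i) \<odot> v t" if "t \<in> insert y F" for t
    proof -
      have "f \<odot> v t = scalar_op (w t i) \<odot> v t \<oplus> scalar_op (- w y i) \<odot> v t"
        unfolding f_def weight_spaceD(2)[OF insert.prems(2)[OF that], of i, symmetric]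
        using vc[OF that] by (intro act_plus IDO_intros)
      then show ?thesis using act_scalar_add[OF vc[OF that], of "w t i" "- w y i"] by simp
    qed
    have "f \<odot> finsum M v (insert y F) \<in> K"
      using insert.prems(3) f by (intro Km)
    also have "f \<odot> finsum M v (insert y F) = (\<Oplus>t\<in>insert y F. f \<odot> v t)"
      by (rule finsum_smult[OF f vyF])
    also have "\<dots> = (\<Oplus>t\<in>insert y F. scalar_op (w t i - w y i) \<odot> v t)"
      using vc by (intro finsum_cong') (auto simp: fv IDO_intros)
    also have "\<dots> = scalar_op (w y i - w y i) \<odot> v y \<oplus> (\<Oplus>t\<in>F. scalar_op (w t i - w y i) \<odot> v t)"
      using insert.hyps vF vy by (intro finsum_insert) (auto simp: IDO_intros Pi_iff)
    also have "\<dots> = (\<Oplus>t\<in>F. scalar_op (w t i - w y i) \<odot> v t)"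
      using vF vy by (simp add: act_scalar_zero IDO_intros Pi_iff)
    finally have "\<forall>t\<in>F. scalar_op (w t i - w y i) \<odot> v t \<in> K"
      using insert.prems by (intro insert.IH) (auto intro: weight_space_scalar)
    then show ?thesis
      using scalar_cancel[OF K, of "w z i - w y i" "v z"] i z vc by auto
  qed
  then have "finsum M v F \<in> K"
    by (intro finsum_in_subgroup[OF Km(6)]) auto
  then have sF: "\<ominus> finsum M v F \<in> K" by (rule Km(3))
  have "finsum M v (insert y F) = v y \<oplus> finsum M v F"
    using insert.hyps vF vy by simp
  then have "v y = finsum M v (insert y F) \<oplus> \<ominus> finsum M v F"
    using vF vy by (simp add: M.a_assoc M.r_neg)
  then have "v y \<in> K"
    using Km(4)[OF insert.prems(3) sF] by simp
  with vF_K show ?case by simp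
qed simp

text \<open>A vanishing sum lies in the zero submodule, hence so does each of its weight
  components.\<close>

lemma weight_family_independent: "independent_family M UNIV (weight_space M)"
  unfolding independent_family_def
proof (intro allI impI, elim conjE)
  fix F v assume F: "finite F" "v \<in> Pi F (weight_space M)" "finsum M v F = \<zero>"
  then have "\<forall>z\<in>F. v z \<in> {\<zero>}"
    by (intro weight_components[OF submodule_zero, where w = "\<lambda>z. z"]) auto
  then show "\<forall>z\<in>F. v z = \<zero>" by simp
qed

lemma weight_moduleI: "carrier M \<subseteq> finite_sums M UNIV (weight_space M) \<Longrightarrow> weight_module M"
  unfolding weight_module_def
  by (intro conjI left_module_axioms internal_direct_sumI weight_space_subgroup weight_family_independent
      abelian_group_axioms)

section \<open>Effect of derivations and integrations on weights\<close>

lemma weight_deriv: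
  assumes v: "v \<in> weight_space M \<mu>"
  shows "deriv_op i \<odot> v \<in> weight_space M (\<mu>(i := \<mu> i - 1))"
proof -
  note vc = weight_spaceD(1)[OF v] and Hv = weight_spaceD(2)[OF v]
  have d: "deriv_op i \<odot> v \<in> carrier M" using vc by (simp add: IDO_intros)
  have "H_op j \<odot> (deriv_op i \<odot> v) = scalar_op ((\<mu>(i := \<mu> i - 1)) j) \<odot> (deriv_op i \<odot> v)" for j
  proof (cases "j = i")
    case False
    then have "H_op j \<odot> (deriv_op i \<odot> v) = deriv_op i \<odot> (H_op j \<odot> v)"
      using vc by (intro act_eq H_deriv IDO_intros)
    with False vc show ?thesis by (simp add: Hv act_scalar_commute IDO_intros)
  next
    case True
    have "deriv_op i \<odot> (H_op i \<odot> v) = (\<lambda>p. (H_op i \<circ> deriv_op i) p + deriv_op i p) \<odot> v"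
      using vc by (subst deriv_H[symmetric]) (simp add: act_comp IDO_intros)
    also have "\<dots> = H_op i \<odot> (deriv_op i \<odot> v) \<oplus> deriv_op i \<odot> v"
      using vc by (subst act_plus) (auto intro: IDO_intros simp: act_comp IDO_generators IDO_H)
    finally have "H_op i \<odot> (deriv_op i \<odot> v) \<oplus> deriv_op i \<odot> v = scalar_op (\<mu> i) \<odot> (deriv_op i \<odot> v)"
      using vc by (simp add: Hv act_scalar_commute IDO_intros)
    also have "\<dots> = scalar_op (\<mu> i - 1) \<odot> (deriv_op i \<odot> v) \<oplus> deriv_op i \<odot> v"
      using act_scalar_add[OF d, of "\<mu> i - 1" 1] by (simp add: act_scalar_one d)
    finally show ?thesis
      using d True by (simp add: IDO_intros)
  qed
  with d show ?thesis by (simp add: weight_space_def)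
qed

lemma weight_integ:
  assumes v: "v \<in> weight_space M \<mu>"
  shows "integ_op i \<odot> v \<in> weight_space M (\<mu>(i := \<mu> i + 1))"
proof -
  note vc = weight_spaceD(1)[OF v] and Hv = weight_spaceD(2)[OF v]
  have d: "integ_op i \<odot> v \<in> carrier M" using vc by (simp add: IDO_intros)
  have "H_op j \<odot> (integ_op i \<odot> v) = scalar_op ((\<mu>(i := \<mu> i + 1)) j) \<odot> (integ_op i \<odot> v)" for j
  proof (cases "j = i")
    case False
    then have "H_op j \<odot> (integ_op i \<odot> v) = integ_op i \<odot> (H_op j \<odot> v)"
      using vc by (intro act_eq H_integ IDO_intros)
    with False vc show ?thesis by (simp add: Hv act_scalar_commute IDO_intros)
  next
    case True
    have "H_op i \<odot> (integ_op i \<odot> v) = (\<lambda>p. (integ_op i \<circ> H_op i) p + integ_op i p) \<odot> v"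
      using vc by (subst H_integ_same[symmetric]) (simp add: act_comp IDO_intros)
    also have "\<dots> = integ_op i \<odot> (H_op i \<odot> v) \<oplus> integ_op i \<odot> v"
      using vc by (subst act_plus) (auto intro: IDO_intros simp: act_comp IDO_generators IDO_H)
    finally show ?thesis
      using vc d True by (simp add: Hv act_scalar_commute IDO_intros act_scalar_add act_scalar_one)
  qed
  with d show ?thesis by (simp add: weight_space_def)
qed

lemma weight_integ_deriv:
  assumes "v \<in> weight_space M \<mu>"
  shows "integ_op i \<odot> (deriv_op i \<odot> v) \<in> weight_space M \<mu>"
  using weight_integ[OF weight_deriv[OF assms, of i], of i] by simp

text \<open>With \<open>w = integ_op i \<odot> (deriv_op i \<odot> v)\<close>, again of weight
  \<open>\<mu>\<close>, applying \<open>H_idempotent\<close> to \<open>v\<close> amounts to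
  \<open>(\<mu> i - 1) (v - w) = 0\<close>.\<close>

lemma integ_deriv_eq:
  assumes v: "v \<in> weight_space M \<mu>" and i: "\<mu> i \<noteq> 1"
  shows "integ_op i \<odot> (deriv_op i \<odot> v) = v"
proof -
  define w where "w = integ_op i \<odot> (deriv_op i \<odot> v)"
  have w: "w \<in> weight_space M \<mu>" unfolding w_def by (rule weight_integ_deriv) fact
  note vc = weight_spaceD(1)[OF v] and wc = weight_spaceD(1)[OF w]
  have w': "(integ_op i \<circ> deriv_op i) \<odot> v = w"
    unfolding w_def using vc by (intro act_comp IDO_intros)
  have "(\<lambda>p. H_op i p + (integ_op i \<circ> deriv_op i) p) \<odot> v = H_op i \<odot> v \<oplus> w"
    using vc by (subst act_plus) (auto simp only: w' intro!: IDO_intros)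
  moreover have "(\<lambda>p. p + (H_op i \<circ> (integ_op i \<circ> deriv_op i)) p) \<odot> v = v \<oplus> H_op i \<odot> w"
    using vc
    by (subst act_plus) (auto simp only: w' act_id act_comp[of "H_op i" "integ_op i \<circ> deriv_op i" v]
        IDO_H IDO_intros(1) IDO_generators intro!: IDO_intros)
  ultimately have eq: "scalar_op (\<mu> i) \<odot> v \<oplus> w = v \<oplus> scalar_op (\<mu> i) \<odot> w"
    using arg_cong[OF H_idempotent[of i], of "\<lambda>f. f \<odot> v"]
    by (simp only: weight_spaceD(2)[OF v] weight_spaceD(2)[OF w])
  have split: "scalar_op (\<mu> i) \<odot> x = scalar_op (\<mu> i - 1) \<odot> x \<oplus> x" if "x \<in> carrier M" for x
    using act_scalar_add[OF that, of "\<mu> i - 1" 1] act_scalar_one[OF that] by simp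
  have cl: "scalar_op c \<odot> x \<in> carrier M" if "x \<in> carrier M" for c x
    using that by (simp add: IDO_intros)
  \<comment> \<open>Writing \<open>\<mu> i\<close> as \<open>(\<mu> i - 1) + 1\<close> on both sides
    exposes the common summand \<open>v \<oplus> w\<close>.\<close>
  have "scalar_op (\<mu> i - 1) \<odot> v \<oplus> (v \<oplus> w) = scalar_op (\<mu> i - 1) \<odot> w \<oplus> (v \<oplus> w)"
    using eq vc wc by (simp add: split M.a_ac cl)
  then have "scalar_op (\<mu> i - 1) \<odot> v = scalar_op (\<mu> i - 1) \<odot> w"
    using vc wc by (simp add: cl)
  then have "scalar_op (inverse (\<mu> i - 1)) \<odot> (scalar_op (\<mu> i - 1) \<odot> v) =
      scalar_op (inverse (\<mu> i - 1)) \<odot> (scalar_op (\<mu> i - 1) \<odot> w)" by simp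
  then show ?thesis
    using i vc wc by (simp add: act_scalar_scalar act_scalar_one w_def)
qed

lemma kernel_proj_decomp:
  assumes v: "v \<in> carrier M"
  shows "v = kernel_proj i \<odot> v \<oplus> integ_op i \<odot> (deriv_op i \<odot> v)"
    and "kernel_proj i \<odot> v = v \<oplus> scalar_op (- 1) \<odot> (integ_op i \<odot> (deriv_op i \<odot> v))"
proof -
  define w where "w = integ_op i \<odot> (deriv_op i \<odot> v)"
  have w: "w \<in> carrier M" unfolding w_def using v by (simp add: IDO_intros)
  show eq: "kernel_proj i \<odot> v = v \<oplus> scalar_op (- 1) \<odot> (integ_op i \<odot> (deriv_op i \<odot> v))"
    unfolding kernel_proj_def using v
    by (subst act_plus) (auto simp: act_id act_comp IDO_generators IDO_intros(1) intro: IDO_intros)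
  show "v = kernel_proj i \<odot> v \<oplus> integ_op i \<odot> (deriv_op i \<odot> v)"
    unfolding eq w_def[symmetric] using v w by (simp add: act_scalar_minus M.a_assoc M.l_neg)
qed

lemma weight_int_shift:
  assumes "v \<in> weight_space M \<mu>"
  shows "int_shift i k \<odot> v \<in> weight_space M (\<mu>(i := \<mu> i + of_int k))"
proof -
  have 1: "(integ_op i ^^ n) \<odot> v \<in> weight_space M (\<mu>(i := \<mu> i + of_nat n))" for n
  proof (induction n)
    case 0
    then show ?case using assms act_id[of v] by (simp add: weight_spaceD(1))
  next
    case (Suc n)
    have "integ_op i ^^ Suc n \<odot> v = integ_op i \<odot> ((integ_op i ^^ n) \<odot> v)"
      using weight_spaceD(1)[OF assms] by (simp only: funpow.simps act_comp IDO_generators funpow_IDO)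
    then show ?case
      using weight_integ[OF Suc, of i] by (simp add: add_ac fun_upd_def cong: if_cong del: funpow.simps)
  qed
  have 2: "(deriv_op i ^^ n) \<odot> v \<in> weight_space M (\<mu>(i := \<mu> i - of_nat n))" for n
  proof (induction n)
    case 0
    then show ?case using assms act_id[of v] by (simp add: weight_spaceD(1))
  next
    case (Suc n)
    have "deriv_op i ^^ Suc n \<odot> v = deriv_op i \<odot> ((deriv_op i ^^ n) \<odot> v)"
      using weight_spaceD(1)[OF assms] by (simp only: funpow.simps act_comp IDO_generators funpow_IDO)
    then show ?case
      using weight_deriv[OF Suc, of i]
      by (simp add: algebra_simps fun_upd_def cong: if_cong del: funpow.simps)
  qed
  show ?thesis
    using 1[of "nat k"] 2[of "nat (- k)"] by (cases "k \<ge> 0") (simp_all add: int_shift_def)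
qed

lemma weight_multi_shift:
  assumes "v \<in> weight_space M \<mu>"
  shows "multi_shift S z \<odot> v \<in> weight_space M (\<lambda>j. if j \<in> S then \<mu> j + of_int (z j) else \<mu> j)"
  using finite[of S]
proof (induction S rule: finite_induct)
  case empty
  then show ?case using assms act_id[of v] by (simp add: weight_spaceD(1) multi_shift_empty)
next
  case (insert i S)
  have "multi_shift (insert i S) z \<odot> v = int_shift i (z i) \<odot> (multi_shift S z \<odot> v)"
    using weight_spaceD(1)[OF assms]
    by (simp only: multi_shift_insert[OF insert(2)] act_comp int_shift_IDO multi_shift_IDO)
  moreover have "(\<lambda>j. if j \<in> S then \<mu> j + of_int (z j) else \<mu> j)(i := \<mu> i + of_int (z i)) =
      (\<lambda>j. if j \<in> insert i S then \<mu> j + of_int (z j) else \<mu> j)"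
    by auto
  ultimately show ?case
    using weight_int_shift[OF insert(3), of i "z i"] insert(2) by simp
qed

section \<open>Submodules of weight modules\<close>

lemma submodule_ido_module: "submodule K IDO M \<Longrightarrow> ido_module (M\<lparr>carrier := K\<rparr>)"
  by (intro ido_module.intro submodule_left_module)

lemma finsum_submodule:
  assumes K: "submodule K IDO M" and v: "v \<in> F \<rightarrow> K"
  shows "finsum (M\<lparr>carrier := K\<rparr>) v F = finsum M v F"
proof -
  interpret K: ido_module "M\<lparr>carrier := K\<rparr>" by (rule submodule_ido_module[OF K])
  have KM: "K \<subseteq> carrier M" by (rule submoduleD[OF K])
  show ?thesis
    using v
  proof (induction F rule: infinite_finite_induct)
    case (infinite F)
    then show ?case by (simp add: M.finsum_infinite K.M.finsum_infinite)
  next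
    case (insert i F)
    then have "v \<in> F \<rightarrow> carrier M" "v i \<in> carrier M" "v \<in> F \<rightarrow> K" "v i \<in> K"
      using KM by auto
    with insert show ?case by simp
  qed simp
qed

lemma weight_space_restrict: "K \<subseteq> carrier M \<Longrightarrow> weight_space (M\<lparr>carrier := K\<rparr>) \<mu> = weight_space M \<mu> \<inter> K"
  by (auto simp: weight_space_def)

text \<open>By \<open>weight_components\<close> the components of a vector of \<open>K\<close> stay
  in \<open>K\<close>. This makes the simple summands found later weight modules.\<close>

lemma submodule_weight_module:
  assumes M: "weight_module M" and K: "submodule K IDO M"
  shows "weight_module (M\<lparr>carrier := K\<rparr>)"
proof (rule ido_module.weight_moduleI[OF submodule_ido_module[OF K]], rule subsetI)
  note Km = submoduleD[OF K]
  fix x assume "x \<in> carrier (M\<lparr>carrier := K\<rparr>)"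
  then have x: "x \<in> K" by simp
  then have "x \<in> finite_sums M UNIV (weight_space M)"
    using M Km(1) internal_direct_sum_span[OF abelian_group_axioms] by (auto simp: weight_module_def)
  then obtain v F where F: "finite F" "v \<in> Pi F (weight_space M)" "x = finsum M v F"
    unfolding finite_sums_def by blast
  then have "\<forall>z\<in>F. v z \<in> K"
    using x by (intro weight_components[OF K, where w = "\<lambda>z. z"]) auto
  with F have "v \<in> Pi F (weight_space (M\<lparr>carrier := K\<rparr>))" "x = finsum (M\<lparr>carrier := K\<rparr>) v F"
    by (auto simp: weight_space_restrict[OF Km(1)] finsum_submodule[OF K])
  with F(1) show "x \<in> finite_sums (M\<lparr>carrier := K\<rparr>) UNIV (weight_space (M\<lparr>carrier := K\<rparr>))"
    unfolding finite_sums_def by blast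
qed

section \<open>Simple weight modules\<close>

text \<open>If \<open>\<partial>\<^sub>i v = 0\<close>, then \<open>v\<close> generates a copy of \<open>K[x\<^sub>i]\<close> in direction \<open>i\<close>. The other alternative says that
  \<open>\<integral>\<^sub>i\<close> undoes every application of \<open>\<partial>\<^sub>i\<close> to \<open>v\<close>, so that \<open>\<partial>\<^sub>i\<close> and \<open>\<integral>\<^sub>i\<close> act invertibly on the vectors
  obtained from \<open>v\<close>.\<close>

definition pure :: "'n \<Rightarrow> 'm \<Rightarrow> bool" where
  "pure i v \<longleftrightarrow> deriv_op i \<odot> v = \<zero> \<or>
    (\<forall>k<0. integ_op i \<odot> (int_shift i k \<odot> v) = int_shift i (k + 1) \<odot> v)"

text \<open>Applied with \<open>f\<close> built from operators in variables other than
  \<open>i\<close>, so that purity in direction \<open>i\<close> persists while other directions are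
  treated.\<close>

lemma pure_commute:
  assumes v: "v \<in> carrier M" and f: "f \<in> carrier IDO"
    and c: "f \<circ> deriv_op i = deriv_op i \<circ> f" "f \<circ> integ_op i = integ_op i \<circ> f"
    and p: "pure i v"
  shows "pure i (f \<odot> v)"
proof -
  have s: "int_shift i k \<odot> (f \<odot> v) = f \<odot> (int_shift i k \<odot> v)" for k
    using v f by (intro act_eq int_shift_commute_op[symmetric] c int_shift_IDO)
  have d: "deriv_op i \<odot> (f \<odot> v) = f \<odot> (deriv_op i \<odot> v)"
    using v f c by (intro act_eq IDO_intros) auto
  have t: "integ_op i \<odot> (f \<odot> w) = f \<odot> (integ_op i \<odot> w)" if "w \<in> carrier M" for w
    using that f c by (intro act_eq IDO_intros) auto
  show ?thesis
    using p v f unfolding pure_def by (auto simp: s d t int_shift_IDO)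
qed

lemma pure_kernel: "deriv_op i \<odot> v = \<zero> \<Longrightarrow> pure i v"
  by (simp add: pure_def)

text \<open>By \<open>integ_deriv_eq\<close>, integrating back up can fail only at weight one, and
  lowering \<open>\<mu> i\<close> by integer steps meets one only when \<open>\<mu> i\<close> is a
  positive integer.\<close>

lemma pure_weight:
  assumes v: "v \<in> weight_space M \<mu>" and \<mu>: "\<And>n. \<mu> i \<noteq> of_nat (Suc n)"
  shows "pure i v"
proof -
  have "integ_op i \<odot> (int_shift i k \<odot> v) = int_shift i (k + 1) \<odot> v" if "k < 0" for k
  proof -
    have "int_shift i k \<odot> v = deriv_op i \<odot> (int_shift i (k + 1) \<odot> v)"
      using act_comp[OF IDO_generators(3) int_shift_IDO weight_spaceD(1)[OF v], of i i "k + 1"]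
      by (simp only: deriv_int_shift add_diff_cancel_right')
    \<comment> \<open>One is the critical value because \<open>H_op i\<close> is derivation after
      multiplication and so fixes monomials free of the variable \<open>i\<close>.\<close>
    moreover have "\<mu> i + of_int (k + 1) \<noteq> 1"
    proof
      assume "\<mu> i + of_int (k + 1) = 1"
      then have "\<mu> i = of_int (- k)" by (simp add: algebra_simps add_eq_0_iff)
      also have "- k = int (Suc (nat (- k - 1)))" using that by simp
      finally show False using \<mu>[of "nat (- k - 1)"] by (simp only: of_int_of_nat_eq)
    qed
    then have "integ_op i \<odot> (deriv_op i \<odot> (int_shift i (k + 1) \<odot> v)) = int_shift i (k + 1) \<odot> v"
      using integ_deriv_eq[OF weight_int_shift[OF v, of i "k + 1"], of i] by simp
    ultimately show ?thesis by simp
  qed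
  then show ?thesis by (simp add: pure_def)
qed

section \<open>The submodule generated by a pure weight vector\<close>

definition orbit :: "'m \<Rightarrow> ('n \<Rightarrow> int) \<Rightarrow> 'm" where
  "orbit v z = multi_shift UNIV z \<odot> v"

text \<open>A \<open>K\<close>-span written as a sum of lines, one for each \<open>z\<close>, so
  that the facts on \<open>finite_sums\<close> and \<open>weight_components\<close> apply
  directly.\<close>

definition orbit_span :: "'m \<Rightarrow> 'm set" where
  "orbit_span v = finite_sums M UNIV (\<lambda>z. range (\<lambda>c. scalar_op c \<odot> orbit v z))"

context
  fixes v \<mu>
  assumes v: "v \<in> weight_space M \<mu>" and pure: "\<And>i. pure i v"
begin

lemma v_carrier: "v \<in> carrier M"
  using weight_spaceD(1)[OF v] .

lemma orbit_weight: "orbit v z \<in> weight_space M (\<lambda>j. \<mu> j + of_int (z j))"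
  unfolding orbit_def using weight_multi_shift[OF v, of UNIV z] by simp

lemma orbit_carrier: "orbit v z \<in> carrier M"
  using weight_spaceD(1)[OF orbit_weight] .

lemma orbit_zero: "orbit v (\<lambda>_. 0) = v"
  by (simp only: orbit_def multi_shift_zero act_id v_carrier)

lemma orbit_update: "orbit v (z(i := k)) = int_shift i k \<odot> (multi_shift (- {i}) z \<odot> v)"
  unfolding orbit_def multi_shift_update(1)
  by (rule act_comp[OF int_shift_IDO multi_shift_IDO v_carrier])

lemma deriv_orbit_update: "deriv_op i \<odot> orbit v (z(i := k)) = orbit v (z(i := k - 1))"
proof -
  have c: "multi_shift (- {i}) z \<odot> v \<in> carrier M"
    using v_carrier by (simp add: multi_shift_IDO)
  show ?thesis
    unfolding orbit_update deriv_int_shift[symmetric]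
    by (rule act_comp[OF IDO_generators(3) int_shift_IDO c, symmetric])
qed

lemma integ_orbit_update_nonneg:
  "k \<ge> 0 \<Longrightarrow> integ_op i \<odot> orbit v (z(i := k)) = orbit v (z(i := k + 1))"
proof -
  assume k: "k \<ge> 0"
  have c: "multi_shift (- {i}) z \<odot> v \<in> carrier M"
    using v_carrier by (simp add: multi_shift_IDO)
  show ?thesis
    unfolding orbit_update integ_int_shift[OF k, symmetric]
    by (rule act_comp[OF IDO_generators(4) int_shift_IDO c, symmetric])
qed

text \<open>Let \<open>w\<close> be \<open>v\<close> shifted in the other directions; it is still
  pure in direction \<open>i\<close>. If \<open>deriv_op i\<close> killed \<open>w\<close>, every
  negative shift in direction \<open>i\<close> would vanish, contrary to \<open>nz\<close>; so the
  other alternative of purity holds.\<close>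

lemma integ_orbit_update_neg:
  assumes k: "k < 0" and nz: "orbit v (z(i := k)) \<noteq> \<zero>"
  shows "integ_op i \<odot> orbit v (z(i := k)) = orbit v (z(i := k + 1))"
proof -
  define w where "w = multi_shift (- {i}) z \<odot> v"
  have w: "w \<in> carrier M"
    unfolding w_def using v_carrier by (simp add: multi_shift_IDO)
  have "pure i w"
    unfolding w_def
    by (rule pure_commute[OF v_carrier multi_shift_IDO _ _ pure]) (simp_all add: multi_shift_commute)
  moreover have "deriv_op i \<odot> w \<noteq> \<zero>"
  proof
    assume z: "deriv_op i \<odot> w = \<zero>"
    have "int_shift i k \<odot> w = int_shift i (k + 1) \<odot> (deriv_op i \<odot> w)"
      unfolding int_shift_neg[OF k] by (rule act_comp[OF int_shift_IDO IDO_generators(3) w])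
    with z nz show False by (simp add: orbit_update w_def int_shift_IDO)
  qed
  ultimately show ?thesis
    using k by (simp add: pure_def orbit_update w_def)
qed

text \<open>The exceptional case can occur: if \<open>deriv_op i \<odot> v = \<zero>\<close> and
  \<open>z i = -1\<close>, then \<open>orbit v z\<close> vanishes while its successor may
  not.\<close>

lemma integ_orbit:
  "integ_op i \<odot> orbit v z = orbit v (z(i := z i + 1)) \<or> orbit v z = \<zero>"
  using integ_orbit_update_nonneg[of "z i" i z] integ_orbit_update_neg[of "z i" z i]
  by (cases "z i \<ge> 0") auto

lemma orbit_line_subgroup: "subgroup (range (\<lambda>c. scalar_op c \<odot> orbit v z)) (add_monoid M)"
proof (rule subgroup.intro)
  have "\<ominus> (scalar_op c \<odot> orbit v z) = scalar_op (- 1 * c) \<odot> orbit v z" for c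
    using orbit_carrier by (simp only: act_scalar_minus[symmetric] act_scalar_scalar smult_closed IDO_generators)
  then show "inv\<^bsub>add_monoid M\<^esub> x \<in> range (\<lambda>c. scalar_op c \<odot> orbit v z)"
    if "x \<in> range (\<lambda>c. scalar_op c \<odot> orbit v z)" for x
    using that by (auto simp only: a_inv_def[symmetric])
  show "\<one>\<^bsub>add_monoid M\<^esub> \<in> range (\<lambda>c. scalar_op c \<odot> orbit v z)"
    using act_scalar_zero[OF orbit_carrier, of z] by (metis monoid.simps(2) rangeI)
  show "x \<otimes>\<^bsub>add_monoid M\<^esub> y \<in> range (\<lambda>c. scalar_op c \<odot> orbit v z)"
    if "x \<in> range (\<lambda>c. scalar_op c \<odot> orbit v z)" "y \<in> range (\<lambda>c. scalar_op c \<odot> orbit v z)" for x y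
    using that act_scalar_add[OF orbit_carrier, of _ _ z, symmetric] by auto
qed (use orbit_carrier in \<open>auto simp: IDO_generators\<close>)

lemma orbit_line_in_span: "scalar_op c \<odot> orbit v z \<in> orbit_span v"
  unfolding orbit_span_def using subgroup_add_facts(2)[OF orbit_line_subgroup]
  by (intro finite_sums_incl[of z]) auto

lemma orbit_span_add: "x \<in> orbit_span v \<Longrightarrow> y \<in> orbit_span v \<Longrightarrow> x \<oplus> y \<in> orbit_span v"
  unfolding orbit_span_def by (rule finite_sums_add[OF orbit_line_subgroup])

lemma orbit_span_zero: "\<zero> \<in> orbit_span v"
  using orbit_line_in_span[of 0] act_scalar_zero[OF orbit_carrier] by metis

lemma orbit_span_closed:
  assumes f: "f \<in> carrier IDO" and x: "x \<in> orbit_span v"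
    and line: "\<And>z. \<exists>c y. f \<odot> orbit v z = scalar_op c \<odot> orbit v y"
  shows "f \<odot> x \<in> orbit_span v"
proof (rule finite_sums_map[where h = "\<lambda>x. f \<odot> x" and I = UNIV])
  show "x \<in> finite_sums M UNIV (\<lambda>z. range (\<lambda>c. scalar_op c \<odot> orbit v z))"
    using x by (simp add: orbit_span_def)
  show "f \<odot> x \<in> orbit_span v" if "x \<in> range (\<lambda>c. scalar_op c \<odot> orbit v z)" for z x
  proof -
    obtain a where a: "x = scalar_op a \<odot> orbit v z" using \<open>x \<in> _\<close> by auto
    obtain c y where "f \<odot> orbit v z = scalar_op c \<odot> orbit v y" using line by blast
    then have "f \<odot> x = scalar_op (a * c) \<odot> orbit v y"
      unfolding a act_scalar_commute[OF f orbit_carrier] by (simp add: act_scalar_scalar orbit_carrier)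
    then show ?thesis using orbit_line_in_span by simp
  qed
qed (use f subgroup_add_facts(2)[OF orbit_line_subgroup] orbit_span_zero orbit_span_add in \<open>auto simp: smult_r_distr\<close>)

lemma orbit_span_submodule: "submodule (orbit_span v) IDO M"
proof (rule submodule_IDO_I)
  have one: "\<exists>c y. orbit v z = scalar_op c \<odot> orbit v y" for z
    using act_scalar_one[OF orbit_carrier, of z] by metis
  show "orbit_span v \<subseteq> carrier M"
    using subgroup_add_facts(2)[OF orbit_line_subgroup]
    by (fastforce simp: orbit_span_def finite_sums_def Pi_iff intro!: finsum_closed)
  show "scalar_op c \<odot> x \<in> orbit_span v" if "x \<in> orbit_span v" for c x
    using that by (intro orbit_span_closed IDO_generators) auto
  show "deriv_op i \<odot> x \<in> orbit_span v" if "x \<in> orbit_span v" for i x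
  proof (intro orbit_span_closed IDO_generators that)
    show "\<exists>c y. deriv_op i \<odot> orbit v z = scalar_op c \<odot> orbit v y" for z
      using deriv_orbit_update[of i z "z i"] one by simp
  qed
  show "integ_op i \<odot> x \<in> orbit_span v" if "x \<in> orbit_span v" for i x
  proof (intro orbit_span_closed IDO_generators that)
    show "\<exists>c y. integ_op i \<odot> orbit v z = scalar_op c \<odot> orbit v y" for z
    proof (cases "orbit v z = \<zero>")
      case True
      then show ?thesis using act_scalar_zero[OF orbit_carrier, of z]
        by (intro exI[of _ 0] exI[of _ z]) (simp add: IDO_generators)
    next
      case False
      then show ?thesis using integ_orbit[of i z] one by metis
    qed
  qed
  show "H_op i \<odot> x \<in> orbit_span v" if "x \<in> orbit_span v" for i x
  proof (intro orbit_span_closed IDO_H that)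
    show "\<exists>c y. H_op i \<odot> orbit v z = scalar_op c \<odot> orbit v y" for z
      using weight_spaceD(2)[OF orbit_weight] by blast
  qed
qed (use orbit_span_zero orbit_span_add in auto)

text \<open>Coordinate \<open>i\<close> is driven to zero one unit at a time, by derivation from
  above and by integration from below. Each move stays in \<open>K\<close>, and its result is
  nonzero because the opposite operator returns the previous vector.\<close>

lemma orbit_reset:
  assumes K: "submodule K IDO M" and z: "orbit v (z(i := k)) \<in> K" "orbit v (z(i := k)) \<noteq> \<zero>"
  shows "orbit v (z(i := 0)) \<in> K \<and> orbit v (z(i := 0)) \<noteq> \<zero>"
  using z
proof (induction "nat \<bar>k\<bar>" arbitrary: k rule: less_induct)
  case less
  note act_K = submoduleD(5)[OF K]
  consider "k = 0" | "k > 0" | "k < 0" by linarith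
  then show ?case
  proof cases
    case 1
    then show ?thesis using less.prems by simp
  next
    case 2
    have "orbit v (z(i := k - 1)) \<in> K"
      using act_K[OF IDO_generators(3) less.prems(1), of i] by (simp add: deriv_orbit_update)
    moreover have "orbit v (z(i := k - 1)) \<noteq> \<zero>"
      using integ_orbit_update_nonneg[of "k - 1" i z] less.prems(2) 2 by (auto simp: IDO_generators)
    ultimately show ?thesis using 2 by (intro less.hyps[of "k - 1"]) auto
  next
    case 3
    have "orbit v (z(i := k + 1)) \<in> K"
      using act_K[OF IDO_generators(4) less.prems(1), of i] integ_orbit_update_neg[OF 3 less.prems(2)] by simp
    moreover have "orbit v (z(i := k + 1)) \<noteq> \<zero>"
      using deriv_orbit_update[of i z "k + 1"] less.prems(2) by (auto simp: IDO_generators)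
    ultimately show ?thesis using 3 by (intro less.hyps[of "k + 1"]) auto
  qed
qed

lemma orbit_generates:
  assumes K: "submodule K IDO M" and z: "orbit v z \<in> K" "orbit v z \<noteq> \<zero>"
  shows "v \<in> K"
proof -
  \<comment> \<open>\<open>S\<close> collects the coordinates already reset; for
    \<open>S = UNIV\<close> the vector is \<open>v\<close> itself.\<close>
  have "orbit v (\<lambda>j. if j \<in> S then 0 else z j) \<in> K \<and> orbit v (\<lambda>j. if j \<in> S then 0 else z j) \<noteq> \<zero>" for S
    using finite[of S]
  proof (induction S rule: finite_induct)
    case empty
    then show ?case using z by simp
  next
    case (insert i S)
    let ?z = "\<lambda>j. if j \<in> S then 0 else z j"
    have "?z(i := ?z i) = ?z" "?z(i := 0) = (\<lambda>j. if j \<in> insert i S then 0 else z j)"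
      by auto
    with orbit_reset[OF K, of ?z i "?z i"] insert.IH show ?case by simp
  qed
  from this[of UNIV] show ?thesis by (simp add: orbit_zero)
qed

lemma orbit_span_subset:
  assumes K: "submodule K IDO M" and "v \<in> K"
  shows "orbit_span v \<subseteq> K"
proof
  fix x assume "x \<in> orbit_span v"
  then obtain w F where w: "w \<in> Pi F (\<lambda>z. range (\<lambda>c. scalar_op c \<odot> orbit v z))" "x = finsum M w F"
    by (auto simp: orbit_span_def finite_sums_def)
  have "scalar_op c \<odot> orbit v z \<in> K" for c z
    unfolding orbit_def by (intro submoduleD(5)[OF K] IDO_generators multi_shift_IDO assms)
  then have "w \<in> F \<rightarrow> K" using w(1) by (fastforce simp: Pi_iff)
  then show "x \<in> K"
    unfolding w(2) by (rule finsum_in_subgroup[OF submoduleD(6)[OF K]])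
qed

text \<open>A nonzero vector of a submodule \<open>K\<close> has a nonzero component along some
  orbit vector. That component lies in \<open>K\<close> by \<open>weight_components\<close>, so
  \<open>K\<close> contains \<open>v\<close> by \<open>orbit_generates\<close> and thus the whole
  span.\<close>

lemma orbit_span_simple:
  assumes nz: "v \<noteq> \<zero>"
  shows "simple_module IDO (M\<lparr>carrier := orbit_span v\<rparr>)"
  unfolding simple_module_def
proof (intro conjI allI impI)
  show "left_module IDO (M\<lparr>carrier := orbit_span v\<rparr>)"
    by (rule submodule_left_module[OF orbit_span_submodule])
  have "v \<in> orbit_span v"
    using orbit_line_in_span[of 1 "\<lambda>_. 0"] by (simp only: orbit_zero act_scalar_one v_carrier)
  with nz show "carrier (M\<lparr>carrier := orbit_span v\<rparr>) \<noteq> {\<zero>\<^bsub>M\<lparr>carrier := orbit_span v\<rparr>\<^esub>}" by auto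
  fix K assume "submodule K IDO (M\<lparr>carrier := orbit_span v\<rparr>)"
  then have K: "submodule K IDO M" and sub: "K \<subseteq> orbit_span v"
    using submodule_restrict[OF orbit_span_submodule] by auto
  have "orbit_span v \<subseteq> K" if ne: "K \<noteq> {\<zero>}"
  proof -
    obtain x where x: "x \<in> K" "x \<noteq> \<zero>" using ne submoduleD(2)[OF K] by auto
    then have "x \<in> orbit_span v" using sub by blast
    then obtain w F where w: "finite F" "w \<in> Pi F (\<lambda>z. range (\<lambda>c. scalar_op c \<odot> orbit v z))" "x = finsum M w F"
      unfolding orbit_span_def finite_sums_def by blast
    \<comment> \<open>Distinct \<open>z\<close> give distinct weights because the integers embed
      into a field of characteristic zero; hence the terms of \<open>w\<close> are true weight
      components.\<close>
    have inj: "inj_on (\<lambda>z j. \<mu> j + of_int (z j)) F"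
      by (auto simp: inj_on_def fun_eq_iff)
    have "w z \<in> weight_space M (\<lambda>j. \<mu> j + of_int (z j))" if "z \<in> F" for z
      using Pi_mem[OF w(2) that] weight_space_scalar[OF orbit_weight, of _ z] by auto
    then have wK: "\<forall>z\<in>F. w z \<in> K"
      using w(3) x(1) by (intro weight_components[OF K w(1) inj]) simp_all
    obtain z where z: "z \<in> F" "w z \<noteq> \<zero>"
    proof -
      have "finsum M w F = \<zero>" if "\<forall>z\<in>F. w z = \<zero>"
        using that by (intro M.add.finprod_one_eqI) auto
      then show ?thesis using x(2) w(3) that by blast
    qed
    obtain c where c: "w z = scalar_op c \<odot> orbit v z" using w(2) z(1) by fastforce
    have "c \<noteq> 0" using z(2) act_scalar_zero[OF orbit_carrier, of z] unfolding c by metis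
    then have "orbit v z \<in> K"
      using wK z(1) c by (intro scalar_cancel[OF K _ orbit_carrier, of c]) auto
    moreover have "orbit v z \<noteq> \<zero>"
      using z(2) unfolding c by (auto simp: IDO_generators)
    ultimately show ?thesis
      by (intro orbit_span_subset[OF K] orbit_generates[OF K])
  qed
  then show "K = {\<zero>\<^bsub>M\<lparr>carrier := orbit_span v\<rparr>\<^esub>} \<or> K = carrier (M\<lparr>carrier := orbit_span v\<rparr>)"
    using sub by auto
qed

end

section \<open>Semisimplicity\<close>

text \<open>Directions without purity are treated one after another by splitting with
  \<open>kernel_proj\<close>, until only pure vectors remain, which \<open>simples\<close> places in
  \<open>L\<close>.\<close>

lemma weight_vector_in_sum:
  assumes L: "submodule L IDO M"
    and simples: "\<And>v \<mu>. \<lbrakk>v \<in> weight_space M \<mu>; \<And>i. pure i v; v \<noteq> \<zero>\<rbrakk> \<Longrightarrow> v \<in> L"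
    and v: "v \<in> weight_space M \<mu>"
  shows "v \<in> L"
proof -
  \<comment> \<open>\<open>C\<close> contains the directions in which purity is not yet known; at
    \<open>C = UNIV\<close> nothing about purity is assumed.\<close>
  have "\<forall>\<mu> v. v \<in> weight_space M \<mu> \<longrightarrow> (\<forall>i. i \<notin> C \<longrightarrow> pure i v) \<longrightarrow> v \<in> L" for C
    using finite[of C]
  proof (induction C rule: finite_induct)
    case empty
    then show ?case using simples submoduleD(2)[OF L] by blast
  next
    case (insert i C)
    have step: "v \<in> L" if "v \<in> weight_space M \<mu>" "pure i v" "\<forall>j. j \<notin> insert i C \<longrightarrow> pure j v" for v \<mu>
      using that by (intro insert.IH[rule_format, OF that(1)]) auto
    \<comment> \<open>Induction on the weight in direction \<open>i\<close>: derivation lowers it by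
      one and keeps purity outside \<open>insert i C\<close>. The base is weight zero, where
      \<open>pure_weight\<close> already applies.\<close>
    have int: "v \<in> L" if "v \<in> weight_space M \<mu>" "\<mu> i = of_nat n" "\<forall>j. j \<notin> insert i C \<longrightarrow> pure j v" for v \<mu> n
      using that
    proof (induction n arbitrary: v \<mu>)
      case 0
      have "\<mu> i \<noteq> of_nat (Suc m)" for m using 0(2) by (metis of_nat_eq_iff nat.distinct(1))
      then show ?case using step[OF 0(1) pure_weight[OF 0(1)] 0(3)] by blast
    next
      case (Suc n)
      note vc = weight_spaceD(1)[OF Suc.prems(1)]
      have dc: "deriv_op i \<odot> v \<in> carrier M" using vc by (simp add: IDO_generators)
      have "deriv_op i \<odot> v \<in> L"
      proof (rule Suc.IH[OF weight_deriv[OF Suc.prems(1)]])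
        show "(\<mu>(i := \<mu> i - 1)) i = of_nat n" using Suc.prems(2) by simp
        show "\<forall>j. j \<notin> insert i C \<longrightarrow> pure j (deriv_op i \<odot> v)"
          using Suc.prems(3)
          by (auto intro!: pure_commute[OF vc IDO_generators(3)] deriv_deriv deriv_integ_commute)
      qed
      then have 1: "integ_op i \<odot> (deriv_op i \<odot> v) \<in> L"
        by (rule submoduleD(5)[OF L IDO_generators(4)])
      \<comment> \<open>The projected vector is killed by \<open>deriv_op i\<close>, hence pure in
        direction \<open>i\<close>, and inherits purity outside \<open>insert i C\<close>; only
        \<open>C\<close> remains open, so \<open>step\<close> applies.\<close>
      have 2: "kernel_proj i \<odot> v \<in> L"
      proof (rule step)
        show "kernel_proj i \<odot> v \<in> weight_space M \<mu>"
          unfolding kernel_proj_decomp(2)[OF vc]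
          by (intro weight_space_plus weight_space_scalar weight_integ_deriv Suc.prems)
        have "deriv_op i \<odot> (integ_op i \<odot> (deriv_op i \<odot> v)) = deriv_op i \<odot> v"
          using act_comp[OF IDO_generators(3,4) dc, of i i] act_id(1)[OF dc] deriv_integ[of i] by metis
        then have "deriv_op i \<odot> (scalar_op (- 1) \<odot> (integ_op i \<odot> (deriv_op i \<odot> v))) = \<ominus> (deriv_op i \<odot> v)"
          by (subst act_scalar_commute) (simp_all add: act_scalar_minus IDO_generators dc)
        then have "deriv_op i \<odot> (kernel_proj i \<odot> v) = deriv_op i \<odot> v \<oplus> \<ominus> (deriv_op i \<odot> v)"
          by (simp only: kernel_proj_decomp(2)[OF vc] smult_r_distr smult_closed IDO_generators dc vc)
        then have "deriv_op i \<odot> (kernel_proj i \<odot> v) = \<zero>"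
          using dc by (simp only: M.r_neg)
        then show "pure i (kernel_proj i \<odot> v)" by (rule pure_kernel)
        show "\<forall>j. j \<notin> insert i C \<longrightarrow> pure j (kernel_proj i \<odot> v)"
          using Suc.prems(3)
          by (auto intro!: pure_commute[OF vc kernel_proj_IDO] kernel_proj_commute linear_deriv_op linear_integ_op
              deriv_deriv integ_integ deriv_integ_commute deriv_integ_commute[symmetric])
      qed
      show ?case
        using kernel_proj_decomp(1)[OF vc, of i] submoduleD(4)[OF L 2 1] by simp
    qed
    show ?case
    proof (intro allI impI)
      fix \<mu> v assume v: "v \<in> weight_space M \<mu>" and p: "\<forall>j. j \<notin> insert i C \<longrightarrow> pure j v"
      show "v \<in> L"
      \<comment> \<open>A weight outside the natural numbers gives purity in direction
        \<open>i\<close> at once, by \<open>pure_weight\<close>.\<close>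
      proof (cases "\<exists>n. \<mu> i = of_nat n")
        case True
        then show ?thesis using int v p by blast
      next
        case False
        then show ?thesis using step[OF v pure_weight[OF v] p] by blast
      qed
    qed
  qed
  from this[of UNIV] v show ?thesis by blast
qed

lemma weight_module_direct_sum:
  assumes M: "weight_module M"
  shows "direct_sum_of_simples IDO weight_module M"
proof (rule direct_sum_of_simplesI[where \<A> = "{N. submodule N IDO M \<and> simple_module IDO (M\<lparr>carrier := N\<rparr>)}"])
  fix L assume L: "submodule L IDO M"
    and sub: "\<And>N. N \<in> {N. submodule N IDO M \<and> simple_module IDO (M\<lparr>carrier := N\<rparr>)} \<Longrightarrow> N \<subseteq> L"
  have "v \<in> L" if "v \<in> weight_space M \<mu>" "\<And>i. pure i v" "v \<noteq> \<zero>" for v \<mu>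
  proof -
    have "orbit_span v \<subseteq> L"
      using orbit_span_submodule[OF that(1,2)] orbit_span_simple[OF that] by (intro sub) auto
    then show ?thesis
      using orbit_line_in_span[OF that(1,2), of 1 "\<lambda>_. 0"]
      by (auto simp only: orbit_zero[OF that(1,2)] act_scalar_one weight_spaceD(1)[OF that(1)])
  qed
  then have "weight_space M \<mu> \<subseteq> L" for \<mu>
    using weight_vector_in_sum[OF L] by blast
  then have "finsum M v F \<in> L" if "v \<in> Pi F (weight_space M)" for v F
    using that by (intro finsum_in_subgroup[OF submoduleD(6)[OF L]]) blast
  then show "carrier M \<subseteq> L"
    using internal_direct_sum_span[OF abelian_group_axioms, of UNIV "weight_space M"] M
    unfolding weight_module_def finite_sums_def by blast
qed (use M submodule_weight_module left_module_axioms in auto)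

end

theorem theorem2p5:
  shows "(\<forall>M :: (('n::finite, 'k::field_char_0) mpoly_op, 'm) module.
            weight_module M \<longrightarrow> direct_sum_of_simples IDO weight_module M)
       \<and> semisimple_category IDO
            (weight_module :: (('n, 'k) mpoly_op, 'm) module \<Rightarrow> bool)"
proof -
  have "left_module IDO M \<and> direct_sum_of_simples IDO weight_module M"
    if M: "weight_module M" for M :: "(('n, 'k) mpoly_op, 'm) module"
  proof -
    interpret ido_module M
      using M by (simp add: ido_module_def weight_module_def)
    show ?thesis using left_module_axioms weight_module_direct_sum[OF M] by blast
  qed
  then show ?thesis
    unfolding semisimple_category_def by blast
qed

end
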